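(* Let $H$ be a finite simple graph with $|V(H)|=n$, let $m=\operatorname{girth}(H)$, let $G=W(H)$ be the whisker graph of $H$, let $\mathbb{K}$ be a field, and let $R=\mathbb{K}[V(G)]$ be the polynomial ring whose variables are the vertices of $G$. Then for integers $q$, $$\operatorname{depth}\bigl(R/I(G)^{[q]}\bigr)=\begin{cases} n+q-1, & \text{if } m<\infty \text{ and } 1\le q\le \lfloor m/2\rfloor,\\ n, & \text{if } m \text{ is odd and } q=\lceil m/2\rceil,\\ n+q-1, & \text{if } m=\infty \text{ and } 1\le q\le \nu(G).\end{cases}$$
   Context: For a finite simple graph $H$ with vertices $x_1,\dots,x_n$, the whisker graph $W(H)$ has vertex set $\{x_1,\dots,x_n,y_1,\dots,y_n\}$ (the $y_i$ being new vertices) and edge set $E(H)\cup\{\{x_i,y_i\}: 1\le i\le n\}$. The girth of $H$ is the length of its shortest cycle, with $\operatorname{girth}(H)=\infty$ if $H$ is acyclic. The matching number $\nu(G)$ is the maximum size of a set of pairwise disjoint edges of $G$. For $q\ge1$, the $q$-th squarefree power $I(G)^{[q]}\subseteq R$ of the edge ideal is the ideal generated by the monomials $\prod_{x\in e_1\cup\cdots\cup e_q}x$ where $e_1,\dots,e_q$ are pairwise disjoint edges of $G$. *)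

theory Defs
  imports
    Complex_Main
    "HOL-Library.Cardinality"
    "HOL-Library.Disjoint_Sets"
    "HOL-Library.Extended_Nat"
    "HOL-Library.Poly_Mapping"
begin

section \<open>Graphs\<close>

text \<open>
  A finite simple graph has a finite type \<open>'v\<close> as its vertex set and is given by its set of
  edges, which are two-element sets of vertices.
\<close>

definition simple_graph :: "'v::finite set set \<Rightarrow> bool" where
  "simple_graph E \<longleftrightarrow> (\<forall>e\<in>E. card e = 2)"

text \<open>The cycle \<open>c\<^sub>0, c\<^sub>1, \<dots>, c\<^sub>k\<^sub>-\<^sub>1, c\<^sub>0\<close> is represented by the list of its \<open>k\<close> vertices.\<close>

definition is_cycle :: "'v::finite set set \<Rightarrow> 'v list \<Rightarrow> bool" where
  "is_cycle E c \<longleftrightarrow> 3 \<le> length c \<and> distinct c \<and>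
     (\<forall>i<length c. {c ! i, c ! (Suc i mod length c)} \<in> E)"

text \<open>For an acyclic graph this is the infimum of the empty set in \<^typ>\<open>enat\<close>, which is \<open>\<infinity>\<close>.\<close>

definition girth :: "'v::finite set set \<Rightarrow> enat" where
  "girth E = Inf {enat (length c) | c. is_cycle E c}"

definition matching :: "'v::finite set set \<Rightarrow> 'v set set \<Rightarrow> bool" where
  "matching E M \<longleftrightarrow> M \<subseteq> E \<and> disjoint M"

definition matching_number :: "'v::finite set set \<Rightarrow> nat" where
  "matching_number E = Max {card M | M. matching E M}"

text \<open>\<open>Inl x\<close> is the original vertex \<open>x\<close>, and \<open>Inr x\<close> is the new vertex attached to it.\<close>

definition whisker :: "'v::finite set set \<Rightarrow> ('v + 'v) set set" where
  "whisker E = (\<lambda>e. Inl ` e) ` E \<union> range (\<lambda>x. {Inl x, Inr x})"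


section \<open>Polynomials, ideals and depth\<close>

text \<open>Polynomials over \<open>'k\<close> whose variables are all the elements of \<open>'v\<close>.\<close>

type_synonym ('v, 'k) mpoly = "('v \<Rightarrow>\<^sub>0 nat) \<Rightarrow>\<^sub>0 'k"

definition Var :: "'v \<Rightarrow> ('v, 'k::comm_ring_1) mpoly" where
  "Var v = Poly_Mapping.single (Poly_Mapping.single v 1) 1"

interpretation ideal: module "(*) :: 'r::comm_ring_1 \<Rightarrow> 'r \<Rightarrow> 'r"
  by standard (simp_all add: algebra_simps)

definition ideal_gen :: "'r::comm_ring_1 set \<Rightarrow> 'r set" where
  "ideal_gen S = ideal.span S"

definition irrelevant_ideal :: "('v, 'k::comm_ring_1) mpoly set" where
  "irrelevant_ideal = ideal_gen (range Var)"

text \<open>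
  Regular sequences on the module \<open>R/J\<close>, written in terms of ideals of \<open>R\<close>: multiplication by
  \<open>f\<^sub>i\<close> is injective on \<open>R/(J + (f\<^sub>0, \<dots>, f\<^sub>i\<^sub>-\<^sub>1))\<close> for every \<open>i\<close>, and
  \<open>R/(J + (f\<^sub>0, \<dots>, f\<^sub>r\<^sub>-\<^sub>1))\<close> is not zero.
\<close>

definition regular_sequence_mod :: "'r::comm_ring_1 set \<Rightarrow> 'r list \<Rightarrow> bool" where
  "regular_sequence_mod J fs \<longleftrightarrow>
     (\<forall>i<length fs. \<forall>g. fs ! i * g \<in> ideal_gen (J \<union> set (take i fs))
                         \<longrightarrow> g \<in> ideal_gen (J \<union> set (take i fs))) \<and>
     ideal_gen (J \<union> set fs) \<noteq> UNIV"

text \<open>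
  \<open>depth_mod J\<close> is the depth of \<open>R/J\<close>, the supremum of the lengths of the \<open>R/J\<close>-regular
  sequences in the graded maximal ideal of \<open>R\<close>. The elements of the sequences need not be
  homogeneous.
\<close>

definition depth_mod :: "('v, 'k::comm_ring_1) mpoly set \<Rightarrow> enat" where
  "depth_mod J = Sup {enat (length fs) | fs. set fs \<subseteq> irrelevant_ideal \<and> regular_sequence_mod J fs}"

text \<open>
  Pairwise disjoint edges are in particular distinct, so \<open>q\<close> of them form a matching of
  cardinality \<open>q\<close>.
\<close>

definition squarefree_power :: "'v::finite set set \<Rightarrow> nat \<Rightarrow> ('v, 'k::comm_ring_1) mpoly set" where
  "squarefree_power E q = ideal_gen {\<Prod>x\<in>\<Union>M. Var x | M. matching E M \<and> card M = q}"

end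

theory Submission
  imports Defs
begin

text \<open>
  Let \<open>\<Delta>\<close> be the family of all vertex sets of \<open>G = W(H)\<close> that contain no \<open>q\<close> pairwise disjoint edges.
  It is closed under subsets, and \<open>I(G)\<^sup>[\<^sup>q\<^sup>]\<close> is its Stanley--Reisner ideal \<open>J\<close>. Each of the three
  values of the depth is the size of a facet of \<open>\<Delta>\<close>.

  Upper bound (\<open>depth_le_facet\<close>): a regular sequence \<open>f\<^sub>1, \<dots>, f\<^sub>r\<close> on \<open>R/J\<close> is not longer than any
  facet \<open>W\<close>. Let \<open>u\<close> be the product of the variables in \<open>W\<close>; modulo \<open>J\<close> it is annihilated by the prime
  ideal \<open>P\<close> generated by the other variables. The powers \<open>f\<^sub>i\<^sup>t\<close> again form a regular sequence. If
  \<open>r > |W|\<close>, they are algebraically dependent modulo \<open>P\<close>, so some polynomial expression \<open>\<Phi>\<close> in them with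
  scalar coefficients, not all zero, satisfies \<open>\<Phi> u \<in> J\<close>. Regularity then forces
  \<open>u \<in> J + (f\<^sub>1\<^sup>t, \<dots>, f\<^sub>r\<^sup>t)\<close>, which fails for reasons of degree once \<open>t > |W|\<close>. One facet consists of all
  new vertices and \<open>q - 1\<close> original ones, and has \<open>n + q - 1\<close> elements. If \<open>H\<close> has a cycle with \<open>2q - 1\<close>
  vertices, then these vertices and the new vertices attached to all the others form a facet with
  \<open>n\<close> elements.

  Lower bound (\<open>depth_ge_decomposable\<close>): one sequence serves for all complexes, namely the elementary
  symmetric polynomials \<open>e\<^sub>d, \<dots>, e\<^sub>1\<close> in all the variables. It is regular on the polynomial ring in any
  \<open>d\<close> or more of the variables, and by the exact sequence
  \<open>0 \<rightarrow> R/(J : x) \<rightarrow> R/J \<rightarrow> R/(J + (x)) \<rightarrow> 0\<close> it is regular on \<open>R/J\<close> if it is regular on the two outer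
  modules. For a variable \<open>x\<close> these belong to the star and to the deletion of the vertex \<open>x\<close>. So it
  suffices to take \<open>\<Delta>\<close> apart, vertex by vertex, until only simplices with at least \<open>d\<close> vertices are left.

  To do so, decide for one original vertex after the other whether it is taken, and stop as soon as
  all but \<open>q - 1\<close> of them have been rejected: then the vertices that were not rejected form a simplex,
  with \<open>n + q - 1\<close> elements, because every edge has an original vertex. Otherwise a set \<open>X\<close> of at least \<open>q\<close> original vertices is taken, and what
  remains to be chosen is a set \<open>Z \<subseteq> X\<close> of vertices whose whiskers are used, subject to
  \<open>|Z| + \<nu>(H[X - Z]) < q\<close>. If every cycle of \<open>H\<close> has at least \<open>2q\<close> vertices and \<open>H[X]\<close> has a cycle,
  then no \<open>Z\<close> is admissible. If \<open>H[X]\<close> is a forest, let \<open>v\<close> be a leaf with neighbour \<open>w\<close>. Choosing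
  the whisker of \<open>v\<close> leaves the same problem for \<open>X - v\<close> and \<open>q - 1\<close>. Rejecting it leaves the problem
  for \<open>X - v - w\<close> and \<open>q - 1\<close>, with the whisker of \<open>w\<close> free, since \<open>v\<close> can be matched only to \<open>w\<close>:
  one of the edges at \<open>w\<close> counts in either case. An isolated vertex \<open>v\<close> affects only the
  number \<open>|Z|\<close>; rejecting its whisker leaves the problem for \<open>X - v\<close> and \<open>q\<close>. All simplices that occur have at least \<open>n + q - 1\<close>
  vertices (\<open>decomposable_forest\<close>). Without a condition on cycles, deciding about all whiskers of \<open>X\<close>
  still gives simplices with at least \<open>n\<close> vertices, which is the bound needed for a shortest cycle
  with \<open>2q - 1\<close> vertices.
\<close>

section \<open>Regular sequences modulo an ideal\<close>

text \<open>
  For the ring as a module over itself this rule is associativity of multiplication, oriented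
  against the ring normalisation rules; together the two do not terminate.
\<close>

declare ideal.scale_scale [simp del]

lemma in_ideal_gen_insert:
  assumes "ideal.subspace J"
  shows "g \<in> ideal_gen (insert f J) \<longleftrightarrow> (\<exists>h. g - h * f \<in> J)"
  unfolding ideal_gen_def ideal.span_breakdown_eq ideal.span_eq_iff[THEN iffD2, OF assms] ..

lemma mem_eqI: "a \<in> S \<Longrightarrow> a = b \<Longrightarrow> b \<in> S"
  by simp

lemma ideal_ideal_gen: "ideal.subspace (ideal_gen S)"
  by (simp add: ideal_gen_def)

text \<open>
  The recursion replaces the ideal rather than keeping it and collecting the earlier elements, so
  that inductions over the sequence generalise over the ideal. Nothing is said about the quotient
  by the whole sequence being nonzero: thus the condition holds for the unit ideal, as the
  decompositions below require.
\<close>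

fun reg_on :: "'r::comm_ring_1 set \<Rightarrow> 'r list \<Rightarrow> bool" where
  "reg_on J [] \<longleftrightarrow> True"
| "reg_on J (f # fs) \<longleftrightarrow> (\<forall>g. f * g \<in> J \<longrightarrow> g \<in> J) \<and> reg_on (ideal_gen (insert f J)) fs"

text \<open>
  As a rewrite rule, the implication from \<open>f * g \<in> J\<close> to \<open>g \<in> J\<close> would call itself on its own condition.
\<close>

declare reg_on.simps(2) [simp del]

lemma reg_on_ConsI:
  "(\<And>g. f * g \<in> J \<Longrightarrow> g \<in> J) \<Longrightarrow> reg_on (ideal_gen (insert f J)) fs \<Longrightarrow> reg_on J (f # fs)"
  unfolding reg_on.simps by blast

lemma reg_on_ConsD:
  assumes "reg_on J (f # fs)"
  shows "\<And>g. f * g \<in> J \<Longrightarrow> g \<in> J" "reg_on (ideal_gen (insert f J)) fs"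
  using assms unfolding reg_on.simps by blast+

lemma ideal_gen_ideal_gen_Un: "ideal_gen (ideal_gen S \<union> T) = ideal_gen (S \<union> T)"
proof
  show "ideal_gen (ideal_gen S \<union> T) \<subseteq> ideal_gen (S \<union> T)"
    unfolding ideal_gen_def
    by (rule ideal.span_minimal) (auto simp: ideal.span_base intro: subsetD[OF ideal.span_mono])
  show "ideal_gen (S \<union> T) \<subseteq> ideal_gen (ideal_gen S \<union> T)"
    unfolding ideal_gen_def by (rule ideal.span_mono) (auto simp: ideal.span_base)
qed

lemma ideal_gen_ideal: "ideal.subspace J \<Longrightarrow> ideal_gen J = J"
  by (simp add: ideal_gen_def)

lemma reg_on_iff:
  assumes "ideal.subspace J"
  shows "reg_on J fs \<longleftrightarrow> (\<forall>i<length fs. \<forall>g. fs ! i * g \<in> ideal_gen (J \<union> set (take i fs))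
                         \<longrightarrow> g \<in> ideal_gen (J \<union> set (take i fs)))"
  using assms
proof (induction fs arbitrary: J)
  case (Cons f fs)
  have *: "ideal_gen (J \<union> set (take (Suc i) (f # fs)))
      = ideal_gen (ideal_gen (insert f J) \<union> set (take i fs))" for i
    by (simp add: ideal_gen_ideal_gen_Un)
  show ?case
    by (simp only: reg_on.simps Cons.IH[OF ideal_ideal_gen] length_Cons *
        All_less_Suc2 nth_Cons_0 nth_Cons_Suc)
      (simp add: ideal_gen_ideal[OF Cons.prems])
qed simp

lemma regular_sequence_mod_iff:
  assumes "ideal.subspace J"
  shows "regular_sequence_mod J fs \<longleftrightarrow> reg_on J fs \<and> ideal_gen (J \<union> set fs) \<noteq> UNIV"
  using reg_on_iff[OF assms] by (auto simp: regular_sequence_mod_def)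

lemma ideal_gen_insert_commute:
  "ideal_gen (insert f (ideal_gen (insert x J))) = ideal_gen (insert x (ideal_gen (insert f J)))"
  using ideal_gen_ideal_gen_Un[of "insert x J" "{f}"] ideal_gen_ideal_gen_Un[of "insert f J" "{x}"]
  by (simp add: insert_commute)

lemma ideal_colon: "ideal.subspace J \<Longrightarrow> ideal.subspace {h. x * h \<in> J}"
  unfolding ideal.subspace_def by (simp add: distrib_left) (metis mult.left_commute mult.assoc)

text \<open>
  This is regularity on the middle term of \<open>0 \<rightarrow> R/(J : x) \<rightarrow> R/J \<rightarrow> R/(J + (x)) \<rightarrow> 0\<close>. Regularity of the
  first element on the right-hand term keeps the sequence exact modulo that element, which in terms
  of ideals means that \<open>(J + (f)) : x = (J : x) + (f)\<close>; so the argument can be repeated.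
\<close>

lemma reg_on_colon_sum:
  fixes J :: "'r::comm_ring_1 set"
  assumes "ideal.subspace J" "reg_on {h. x * h \<in> J} fs" "reg_on (ideal_gen (insert x J)) fs"
  shows "reg_on J fs"
  using assms
proof (induction fs arbitrary: J)
  case (Cons f fs)
  note J = Cons.prems(1)
  have colon: "x * h \<in> J" if "x * (f * h) \<in> J" for h
    using reg_on_ConsD(1)[OF Cons.prems(2)] that by simp
  have sum: "\<exists>k. g - k * x \<in> J" if "\<exists>k. f * g - k * x \<in> J" for g
    using reg_on_ConsD(1)[OF Cons.prems(3), of g] that unfolding in_ideal_gen_insert[OF J] .
  have f: "g \<in> J" if g: "f * g \<in> J" for g
  proof -
    have "\<exists>k. f * g - k * x \<in> J" by (rule exI[of _ 0]) (simp add: g)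
    with sum obtain k where k: "g - k * x \<in> J" by blast
    have "f * g - f * (g - k * x) \<in> J"
      by (rule ideal.subspace_diff[OF J g ideal.subspace_scale[OF J k]])
    hence "x * (f * k) \<in> J" by (rule mem_eqI) (simp add: algebra_simps)
    hence "x * k \<in> J" by (rule colon)
    from ideal.subspace_add[OF J k this] show "g \<in> J"
      by (rule mem_eqI) (simp add: algebra_simps)
  qed
  have eq: "{h. x * h \<in> ideal_gen (insert f J)} = ideal_gen (insert f {h. x * h \<in> J})"
  proof (intro set_eqI iffI)
    fix h assume "h \<in> {h. x * h \<in> ideal_gen (insert f J)}"
    then obtain g where g: "x * h - g * f \<in> J" by (auto simp: in_ideal_gen_insert[OF J])
    have "f * g - h * x \<in> J"
      by (rule mem_eqI[OF ideal.subspace_neg[OF J g]]) (simp add: algebra_simps)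
    then obtain k where k: "g - k * x \<in> J" using sum by blast
    have "(x * h - g * f) + f * (g - k * x) \<in> J"
      by (rule ideal.subspace_add[OF J g ideal.subspace_scale[OF J k]])
    hence "x * (h - k * f) \<in> J" by (rule mem_eqI) (simp add: algebra_simps)
    thus "h \<in> ideal_gen (insert f {h. x * h \<in> J})"
      by (auto simp: in_ideal_gen_insert[OF ideal_colon[OF J]])
  next
    fix h assume "h \<in> ideal_gen (insert f {h. x * h \<in> J})"
    then obtain k where "x * (h - k * f) \<in> J"
      by (auto simp: in_ideal_gen_insert[OF ideal_colon[OF J]])
    hence "x * h - (x * k) * f \<in> J" by (rule mem_eqI) (simp add: algebra_simps)
    thus "h \<in> {h. x * h \<in> ideal_gen (insert f J)}"
      by (auto simp: in_ideal_gen_insert[OF J])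
  qed
  have "reg_on (ideal_gen (insert f J)) fs"
  proof (rule Cons.IH[OF ideal_ideal_gen])
    show "reg_on {h. x * h \<in> ideal_gen (insert f J)} fs"
      unfolding eq using Cons.prems(2) by (rule reg_on_ConsD)
    show "reg_on (ideal_gen (insert x (ideal_gen (insert f J)))) fs"
      unfolding ideal_gen_insert_commute[of x] using Cons.prems(3) by (rule reg_on_ConsD)
  qed
  with f show ?case by (rule reg_on_ConsI)
qed simp

text \<open>
  Apply the previous lemma to \<open>J + (a b)\<close> and \<open>b\<close>: since \<open>b\<close> is regular on \<open>R/J\<close>, the colon ideal is
  \<open>J + (a)\<close>, and the sum is \<open>J + (b)\<close>.
\<close>

lemma reg_on_mult:
  fixes J :: "'r::comm_ring_1 set"
  assumes J: "ideal.subspace J" and a: "reg_on J (a # fs)" and b: "reg_on J (b # fs)"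
  shows "reg_on J (a * b # fs)"
proof -
  note ra = reg_on_ConsD(1)[OF a] and rb = reg_on_ConsD(1)[OF b]
  have rab: "g \<in> J" if "a * b * g \<in> J" for g
    using rb[OF ra[of "b * g"]] that unfolding mult.assoc .
  have colon: "{h. b * h \<in> ideal_gen (insert (a * b) J)} = ideal_gen (insert a J)"
  proof (intro set_eqI iffI)
    fix h assume "h \<in> {h. b * h \<in> ideal_gen (insert (a * b) J)}"
    then obtain k where "b * h - k * (a * b) \<in> J" by (auto simp: in_ideal_gen_insert[OF J])
    hence "b * (h - k * a) \<in> J" by (rule mem_eqI) (simp add: algebra_simps)
    hence "h - k * a \<in> J" by (rule rb)
    thus "h \<in> ideal_gen (insert a J)" by (auto simp: in_ideal_gen_insert[OF J])
  next
    fix h assume "h \<in> ideal_gen (insert a J)"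
    then obtain k where "h - k * a \<in> J" by (auto simp: in_ideal_gen_insert[OF J])
    hence "b * (h - k * a) \<in> J" by (rule ideal.subspace_scale[OF J])
    hence "b * h - k * (a * b) \<in> J" by (rule mem_eqI) (simp add: algebra_simps)
    thus "h \<in> {h. b * h \<in> ideal_gen (insert (a * b) J)}" by (auto simp: in_ideal_gen_insert[OF J])
  qed
  have ab: "a * b \<in> ideal_gen (insert b J)"
    by (simp add: ideal_gen_def ideal.span_scale ideal.span_base)
  have sum: "ideal_gen (insert b (ideal_gen (insert (a * b) J))) = ideal_gen (insert b J)"
    unfolding ideal_gen_insert_commute[of b "a * b"]
    using ab by (simp add: insert_absorb ideal_gen_ideal[OF ideal_ideal_gen])
  have "reg_on (ideal_gen (insert (a * b) J)) fs"
    by (rule reg_on_colon_sum[OF ideal_ideal_gen, where x = b]) (simp_all add: colon sum reg_on_ConsD(2)[OF a] reg_on_ConsD(2)[OF b])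
  with rab show ?thesis by (rule reg_on_ConsI)
qed

lemma reg_on_prod:
  fixes J :: "'r::comm_ring_1 set"
  assumes J: "ideal.subspace J" and "finite A" "A \<noteq> {}" "\<And>i. i \<in> A \<Longrightarrow> reg_on J (x i # fs)"
  shows "reg_on J ((\<Prod>i\<in>A. x i) # fs)"
  using assms(2-)
  by (induction A rule: finite_ne_induct) (auto intro: reg_on_mult[OF J])

lemma reg_on_Cons_power:
  fixes J :: "'r::comm_ring_1 set"
  assumes J: "ideal.subspace J" and "reg_on J (f # fs)" "t > 0"
  shows "reg_on J (f ^ t # fs)"
  using reg_on_prod[OF J, of "{..<t}" "\<lambda>_. f" fs] assms by auto

lemma reg_on_powers:
  fixes J :: "'r::comm_ring_1 set"
  assumes "ideal.subspace J" "reg_on J fs" "t > 0"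
  shows "reg_on J (map (\<lambda>f. f ^ t) fs)"
  using assms
proof (induction fs arbitrary: J)
  case (Cons f fs)
  have "reg_on (ideal_gen (insert f J)) (map (\<lambda>f. f ^ t) fs)"
    by (rule Cons.IH[OF ideal_ideal_gen reg_on_ConsD(2)[OF Cons.prems(2)] Cons.prems(3)])
  with reg_on_ConsD(1)[OF Cons.prems(2)] have "reg_on J (f # map (\<lambda>f. f ^ t) fs)"
    by (rule reg_on_ConsI)
  from reg_on_Cons_power[OF Cons.prems(1) this Cons.prems(3)] show ?case by simp
qed simp

lemma ideal_gen_insert_cong:
  fixes J :: "'r::comm_ring_1 set"
  assumes J: "ideal.subspace J" and "f - f' \<in> J"
  shows "ideal_gen (insert f J) = ideal_gen (insert f' J)"
proof -
  have *: "ideal_gen (insert a J) \<subseteq> ideal_gen (insert b J)" if ab: "a - b \<in> J" for a b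
  proof
    fix g assume "g \<in> ideal_gen (insert a J)"
    then obtain k where k: "g - k * a \<in> J" by (auto simp: in_ideal_gen_insert[OF J])
    have "(g - k * a) + k * (a - b) \<in> J"
      by (rule ideal.subspace_add[OF J k ideal.subspace_scale[OF J ab]])
    hence "g - k * b \<in> J" by (rule mem_eqI) (simp add: algebra_simps)
    thus "g \<in> ideal_gen (insert b J)" by (auto simp: in_ideal_gen_insert[OF J])
  qed
  show ?thesis
    using *[OF assms(2)] *[of f' f] ideal.subspace_neg[OF J assms(2)] by auto
qed

lemma reg_on_Cons_cong:
  fixes J :: "'r::comm_ring_1 set"
  assumes J: "ideal.subspace J" and d: "f - f' \<in> J" and r: "reg_on J (f' # fs)"
  shows "reg_on J (f # fs)"
proof -
  have "g \<in> J" if g: "f * g \<in> J" for g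
  proof -
    have "f * g - g * (f - f') \<in> J"
      by (rule ideal.subspace_diff[OF J g ideal.subspace_scale[OF J d]])
    hence "f' * g \<in> J" by (rule mem_eqI) (simp add: algebra_simps)
    with r show ?thesis by (rule reg_on_ConsD)
  qed
  thus ?thesis
    using reg_on_ConsD(2)[OF r] unfolding ideal_gen_insert_cong[OF J d, symmetric]
    by (rule reg_on_ConsI)
qed

section \<open>Stanley--Reisner ideals\<close>

abbreviation keys :: "('a \<Rightarrow>\<^sub>0 'b::zero) \<Rightarrow> 'a set" where
  "keys \<equiv> Poly_Mapping.keys"

abbreviation lookup :: "('a \<Rightarrow>\<^sub>0 'b::zero) \<Rightarrow> 'a \<Rightarrow> 'b" where
  "lookup \<equiv> Poly_Mapping.lookup"

abbreviation single :: "'a \<Rightarrow> 'b \<Rightarrow> 'a \<Rightarrow>\<^sub>0 'b::zero" where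
  "single \<equiv> Poly_Mapping.single"

lemma poly_sum_terms: "p = (\<Sum>m\<in>keys p. single m (lookup p m))"
proof (rule poly_mapping_eqI)
  fix k
  show "lookup p k = lookup (\<Sum>m\<in>keys p. single m (lookup p m)) k"
    by (cases "k \<in> keys p")
      (auto simp: lookup_sum lookup_single when_def sum.delta[OF finite_keys] in_keys_iff
         intro!: sum.neutral)
qed

lemma keys_add_nat: "keys (m + k :: 'v \<Rightarrow>\<^sub>0 nat) = keys m \<union> keys k"
  by (auto simp: in_keys_iff lookup_add)

lemma lookup_monomial_mult:
  fixes p :: "('v \<Rightarrow>\<^sub>0 nat) \<Rightarrow>\<^sub>0 'k::comm_ring_1"
  shows "lookup (single a c * p) (a + m) = c * lookup p m"
proof -
  have "single a c * p = (\<Sum>k\<in>keys p. single (a + k) (c * lookup p k))"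
    by (subst poly_sum_terms[of p]) (simp add: sum_distrib_left mult_single)
  thus ?thesis
    by (simp add: lookup_sum lookup_single when_def sum.delta[OF finite_keys] in_keys_iff)
qed

definition squarefree_mon :: "'v::finite set \<Rightarrow> ('v \<Rightarrow>\<^sub>0 nat)" where
  "squarefree_mon S = (\<Sum>v\<in>S. single v 1)"

lemma lookup_squarefree_mon: "lookup (squarefree_mon S) v = (if v \<in> S then 1 else 0)"
  by (simp add: squarefree_mon_def lookup_sum lookup_single when_def sum.delta)

lemma keys_squarefree_mon [simp]: "keys (squarefree_mon S) = S"
  by (auto simp: in_keys_iff lookup_squarefree_mon split: if_splits)

lemma prod_Var: "(\<Prod>v\<in>S. Var v) = single (squarefree_mon S) (1::'k::comm_ring_1)"
proof -
  have "finite S" by simp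
  thus ?thesis
    by (induction S rule: finite_induct) (simp_all add: squarefree_mon_def Var_def mult_single)
qed

text \<open>
  For a family of sets that is closed under subsets this is the Stanley--Reisner ideal, spanned
  by the monomials whose support is not a face. The empty family gives the unit ideal, and
  \<open>Pow F\<close> the prime ideal generated by the variables outside \<open>F\<close>.
\<close>

definition sr_ideal :: "'v set set \<Rightarrow> ('v, 'k::comm_ring_1) mpoly set" where
  "sr_ideal \<Delta> = {p. \<forall>m\<in>keys p. keys m \<notin> \<Delta>}"

definition down_closed :: "'v set set \<Rightarrow> bool" where
  "down_closed \<Delta> \<longleftrightarrow> (\<forall>S\<in>\<Delta>. \<forall>T\<subseteq>S. T \<in> \<Delta>)"

lemma monomial_ideal:
  fixes U :: "('v \<Rightarrow>\<^sub>0 nat) set"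
  assumes "\<And>m k. m \<in> U \<Longrightarrow> k + m \<in> U"
  shows "ideal.subspace {p :: ('v, 'k::comm_ring_1) mpoly. keys p \<subseteq> U}"
proof (rule ideal.subspaceI)
  fix c p :: "('v, 'k) mpoly" assume "p \<in> {p. keys p \<subseteq> U}"
  thus "c * p \<in> {p. keys p \<subseteq> U}" using keys_mult[of c p] assms by fastforce
next
  fix p q :: "('v, 'k) mpoly"
  assume "p \<in> {p. keys p \<subseteq> U}" "q \<in> {p. keys p \<subseteq> U}"
  thus "p + q \<in> {p. keys p \<subseteq> U}" using Poly_Mapping.keys_add[of p q] by auto
qed simp

lemma ideal_sr_ideal:
  assumes "down_closed \<Delta>"
  shows "ideal.subspace (sr_ideal \<Delta> :: ('v, 'k::comm_ring_1) mpoly set)"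
proof -
  have "ideal.subspace {p :: ('v, 'k) mpoly. keys p \<subseteq> {m. keys m \<notin> \<Delta>}}"
    using assms by (intro monomial_ideal) (auto simp: keys_add_nat down_closed_def)
  thus ?thesis by (simp add: sr_ideal_def subset_eq)
qed

lemma single_in_sr_ideal: "keys m \<notin> \<Delta> \<Longrightarrow> single m c \<in> sr_ideal \<Delta>"
  by (simp add: sr_ideal_def)

text \<open>
  Colon by a variable and adding a variable correspond to the star and the deletion of the vertex,
  both taken on the full vertex set: in the star the vertex is free.
\<close>

lemma sr_ideal_colon:
  fixes v :: 'v
  shows "{h. Var v * h \<in> sr_ideal \<Delta>} = (sr_ideal {S. insert v S \<in> \<Delta>} :: ('v, 'k::comm_ring_1) mpoly set)"
proof -
  have "keys (Var v * h) = (+) (single v 1) ` keys h" for h :: "('v, 'k) mpoly"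
  proof
    show "keys (Var v * h) \<subseteq> (+) (single v 1) ` keys h"
      using keys_mult[of "Var v" h] by (auto simp: Var_def split: if_splits)
    show "(+) (single v 1) ` keys h \<subseteq> keys (Var v * h)"
      by (auto simp: in_keys_iff Var_def lookup_monomial_mult)
  qed
  thus ?thesis by (auto simp: sr_ideal_def keys_add_nat)
qed

lemma Var_dvd_split:
  fixes g :: "('v, 'k::comm_ring_1) mpoly"
  obtains h where "keys (g - h * Var v) \<subseteq> {m \<in> keys g. v \<notin> keys m}"
proof -
  define A where "A = keys g \<inter> {m. v \<in> keys m}"
  define B where "B = keys g - {m. v \<in> keys m}"
  define h where "h = (\<Sum>m\<in>A. single (m - single v 1) (lookup g m))"
  have "m - single v 1 + single v 1 = m"
    if "v \<in> keys m" for m :: "'v \<Rightarrow>\<^sub>0 nat"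
    using that by (intro poly_mapping_eqI)
      (auto simp: lookup_add lookup_minus lookup_single when_def in_keys_iff)
  hence hv: "h * Var v = (\<Sum>m\<in>A. single m (lookup g m))"
    by (auto simp: h_def A_def Var_def sum_distrib_right mult_single intro!: sum.cong)
  have "g = h * Var v + (\<Sum>m\<in>B. single m (lookup g m))"
    unfolding hv A_def B_def
    by (rule trans[OF poly_sum_terms[of g] sum.Int_Diff[OF finite_keys]])
  hence "g - h * Var v = (\<Sum>m\<in>B. single m (lookup g m))"
    by (metis add_diff_cancel_left')
  hence "keys (g - h * Var v) \<subseteq> B"
    using keys_sum[of "\<lambda>m. single m (lookup g m)" B]
    by (auto split: if_splits)
  hence "keys (g - h * Var v) \<subseteq> {m \<in> keys g. v \<notin> keys m}"
    by (auto simp: B_def)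
  thus ?thesis by (rule that)
qed

lemma sr_ideal_sum:
  assumes "down_closed \<Delta>"
  shows "ideal_gen (insert (Var v) (sr_ideal \<Delta>)) = (sr_ideal {S\<in>\<Delta>. v \<notin> S} :: ('v, 'k::comm_ring_1) mpoly set)"
proof
  have "down_closed {S\<in>\<Delta>. v \<notin> S}" using assms by (auto simp: down_closed_def)
  thus "ideal_gen (insert (Var v) (sr_ideal \<Delta>)) \<subseteq> (sr_ideal {S\<in>\<Delta>. v \<notin> S} :: ('v, 'k) mpoly set)"
    unfolding ideal_gen_def
    by (intro ideal.span_minimal ideal_sr_ideal) (auto simp: sr_ideal_def Var_def)
  show "(sr_ideal {S\<in>\<Delta>. v \<notin> S} :: ('v, 'k) mpoly set) \<subseteq> ideal_gen (insert (Var v) (sr_ideal \<Delta>))"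
  proof
    fix g :: "('v, 'k) mpoly" assume g: "g \<in> sr_ideal {S\<in>\<Delta>. v \<notin> S}"
    obtain h where "keys (g - h * Var v) \<subseteq> {m \<in> keys g. v \<notin> keys m}"
      by (rule Var_dvd_split)
    with g have "g - h * Var v \<in> sr_ideal \<Delta>" by (auto simp: sr_ideal_def)
    thus "g \<in> ideal_gen (insert (Var v) (sr_ideal \<Delta>))"
      using in_ideal_gen_insert[OF ideal_sr_ideal[OF assms]] by blast
  qed
qed

definition matching_free :: "'v::finite set set \<Rightarrow> nat \<Rightarrow> 'v set set" where
  "matching_free E q = {S. \<not> (\<exists>M. matching E M \<and> card M = q \<and> \<Union>M \<subseteq> S)}"

lemma down_closed_matching_free: "down_closed (matching_free E q)"
  by (auto simp: down_closed_def matching_free_def)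

lemma squarefree_power_eq:
  "squarefree_power E q = (sr_ideal (matching_free E q) :: ('v::finite, 'k::comm_ring_1) mpoly set)"
proof
  show "squarefree_power E q \<subseteq> (sr_ideal (matching_free E q) :: ('v, 'k) mpoly set)"
    unfolding squarefree_power_def ideal_gen_def
    by (rule ideal.span_minimal[OF _ ideal_sr_ideal[OF down_closed_matching_free]])
      (auto simp: prod_Var matching_free_def intro!: single_in_sr_ideal)
  show "(sr_ideal (matching_free E q) :: ('v, 'k) mpoly set) \<subseteq> squarefree_power E q"
  proof
    fix p :: "('v, 'k) mpoly" assume p: "p \<in> sr_ideal (matching_free E q)"
    have "single m (lookup p m) \<in> squarefree_power E q"
      if m: "m \<in> keys p" for m
    proof -
      have "keys m \<notin> matching_free E q" using p m by (auto simp: sr_ideal_def)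
      then obtain M where M: "matching E M" "card M = q" "\<Union>M \<subseteq> keys m"
        by (auto simp: matching_free_def)
      have "m - squarefree_mon (\<Union>M) + squarefree_mon (\<Union>M) = m"
        using M(3) by (intro poly_mapping_eqI)
          (auto simp: lookup_add lookup_minus lookup_squarefree_mon in_keys_iff)
      hence "single m (lookup p m)
          = single (m - squarefree_mon (\<Union>M)) (lookup p m) * (\<Prod>x\<in>\<Union>M. Var x)"
        by (simp add: prod_Var mult_single)
      also have "\<dots> \<in> squarefree_power E q"
        unfolding squarefree_power_def ideal_gen_def
        by (rule ideal.span_scale, rule ideal.span_base) (use M in blast)
      finally show ?thesis .
    qed
    hence "(\<Sum>m\<in>keys p. single m (lookup p m)) \<in> squarefree_power E q"
      unfolding squarefree_power_def ideal_gen_def by (intro ideal.span_sum)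
    thus "p \<in> squarefree_power E q" by (simp flip: poly_sum_terms)
  qed
qed

section \<open>The grading, and dropping the first element of a regular sequence\<close>

definition mon_degree :: "('v::finite \<Rightarrow>\<^sub>0 nat) \<Rightarrow> nat" where
  "mon_degree m = (\<Sum>v\<in>UNIV. lookup m v)"

lemma mon_degree_add: "mon_degree (m + k) = mon_degree m + mon_degree k"
  by (simp add: mon_degree_def lookup_add sum.distrib)

lemma mon_degree_squarefree_mon: "mon_degree (squarefree_mon S) = card S"
  by (simp add: mon_degree_def lookup_squarefree_mon sum.If_cases)

text \<open>
  Truncations stand for the grading: an ideal is homogeneous iff it is closed under all of them.
\<close>

definition trunc :: "nat \<Rightarrow> ('v::finite, 'k::comm_ring_1) mpoly \<Rightarrow> ('v, 'k) mpoly" where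
  "trunc D p = Poly_Mapping.mapp (\<lambda>m c. if mon_degree m < D then c else 0) p"

lemma lookup_trunc:
  "lookup (trunc D p) m = (if mon_degree m < D then lookup p m else 0)"
  by (simp add: trunc_def lookup_mapp when_def in_keys_iff)

lemma keys_trunc: "keys (trunc D p) = {m \<in> keys p. mon_degree m < D}"
  by (auto simp: in_keys_iff lookup_trunc split: if_splits)

lemma trunc_0 [simp]: "trunc 0 p = 0" "trunc D 0 = 0"
  by (auto intro!: poly_mapping_eqI simp: lookup_trunc)

lemma trunc_diff: "trunc D (p - q) = trunc D p - trunc D q"
  by (rule poly_mapping_eqI) (simp add: lookup_trunc lookup_minus)

lemma trunc_sum: "trunc D (sum f A) = (\<Sum>a\<in>A. trunc D (f a))"
  by (rule poly_mapping_eqI) (simp add: lookup_trunc lookup_sum)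

lemma trunc_single:
  "trunc D (single m c) = (if mon_degree m < D then single m c else 0)"
  by (rule poly_mapping_eqI) (simp add: lookup_trunc lookup_single when_def)

definition homogeneous :: "nat \<Rightarrow> ('v::finite, 'k::comm_ring_1) mpoly \<Rightarrow> bool" where
  "homogeneous e f \<longleftrightarrow> (\<forall>m\<in>keys f. mon_degree m = e)"

text \<open>
  Subtraction of natural numbers gives the right answer for \<open>D < e\<close> as well: both sides vanish.
\<close>

lemma trunc_mult:
  fixes f g :: "('v::finite, 'k::comm_ring_1) mpoly"
  assumes "homogeneous e f"
  shows "trunc D (f * g) = f * trunc (D - e) g"
proof -
  have *: "trunc D (single a x * single b y)
      = single a x * trunc (D - e) (single b y)"
    if "a \<in> keys f" for a b and x y :: 'k
    using assms that by (auto simp: homogeneous_def mult_single trunc_single mon_degree_add)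
  have **: "trunc D (single a x * g) = single a x * trunc (D - e) g"
    if "a \<in> keys f" for a and x :: 'k
  proof -
    have "trunc D (single a x * (\<Sum>m\<in>keys g. single m (lookup g m)))
      = single a x * trunc (D - e) (\<Sum>m\<in>keys g. single m (lookup g m))"
      by (simp only: sum_distrib_left trunc_sum *[OF that])
    thus ?thesis by (simp only: poly_sum_terms[of g, symmetric])
  qed
  have "trunc D ((\<Sum>m\<in>keys f. single m (lookup f m)) * g)
      = (\<Sum>m\<in>keys f. single m (lookup f m)) * trunc (D - e) g"
    unfolding sum_distrib_right trunc_sum by (rule sum.cong[OF refl]) (rule **)
  thus ?thesis by (simp only: poly_sum_terms[of f, symmetric])
qed

lemma homogeneous_single: "mon_degree m = e \<Longrightarrow> homogeneous e (single m c)"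
  by (simp add: homogeneous_def)

lemma homogeneous_mult: "homogeneous d f \<Longrightarrow> homogeneous e g \<Longrightarrow> homogeneous (d + e) (f * g)"
  using keys_mult[of f g] by (fastforce simp: homogeneous_def mon_degree_add)

lemma homogeneous_sum: "(\<And>a. a \<in> A \<Longrightarrow> homogeneous e (f a)) \<Longrightarrow> homogeneous e (sum f A)"
  using keys_sum[of f A] by (fastforce simp: homogeneous_def)

lemma homogeneous_power: "homogeneous e f \<Longrightarrow> homogeneous (k * e) (f ^ k)"
proof (induction k)
  case 0
  show ?case by (simp add: homogeneous_def mon_degree_def)
next
  case (Suc k)
  thus ?case using homogeneous_mult[of e f "k * e" "f ^ k"] by simp
qed

definition graded :: "('v::finite, 'k::comm_ring_1) mpoly set \<Rightarrow> bool" where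
  "graded J \<longleftrightarrow> (\<forall>p\<in>J. \<forall>D. trunc D p \<in> J)"

lemma graded_sr_ideal: "graded (sr_ideal \<Delta>)"
  by (auto simp: graded_def sr_ideal_def keys_trunc)

lemma graded_ideal_gen_insert:
  assumes J: "ideal.subspace J" and "graded J" and "homogeneous e f"
  shows "graded (ideal_gen (insert f J))"
  unfolding graded_def
proof (intro ballI allI)
  fix p D assume "p \<in> ideal_gen (insert f J)"
  then obtain h where "p - h * f \<in> J" by (auto simp: in_ideal_gen_insert[OF J])
  hence "trunc D (p - f * h) \<in> J" using assms(2) by (simp add: graded_def mult.commute)
  hence "trunc D p - trunc (D - e) h * f \<in> J"
    by (simp add: trunc_diff trunc_mult[OF assms(3)] mult.commute)
  thus "trunc D p \<in> ideal_gen (insert f J)" by (auto simp: in_ideal_gen_insert[OF J])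
qed

text \<open>
  Truncate above the degree of \<open>g\<close>; a high enough power of \<open>x\<close> contributes nothing there.
\<close>

lemma graded_separated:
  fixes J :: "('v::finite, 'k::comm_ring_1) mpoly set"
  assumes "graded J" "homogeneous e x" "e > 0" and pow: "\<And>k. \<exists>h. g - x ^ k * h \<in> J"
  shows "g \<in> J"
proof -
  define D where "D = Suc (Max (insert 0 (mon_degree ` keys g)))"
  have "trunc D g = g"
    by (rule poly_mapping_eqI)
      (auto simp: lookup_trunc D_def in_keys_iff not_less less_Suc_eq_le
        intro!: Max_ge dest: leD)
  moreover obtain h where "g - x ^ D * h \<in> J" using pow by blast
  moreover have "trunc D (x ^ D * h) = 0"
    using \<open>e > 0\<close> by (simp add: trunc_mult[OF homogeneous_power[OF assms(2)]])
  ultimately show ?thesis using \<open>graded J\<close> by (metis diff_zero graded_def trunc_diff)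
qed

text \<open>
  Homogeneous regular sequences may be permuted, so the first element can be moved to the end and
  omitted. One exchange of \<open>x\<close> and \<open>f\<close> goes as follows. If \<open>f g \<in> J\<close>, regularity of \<open>f\<close> modulo \<open>J + (x)\<close>
  gives \<open>g = x h\<close> modulo \<open>J\<close>, and \<open>f h \<in> J\<close> since \<open>x\<close> is regular; repeating this puts \<open>g\<close> into
  \<open>J + (x\<^sup>k)\<close> for all \<open>k\<close>, hence into \<open>J\<close>.
\<close>

lemma reg_on_drop:
  fixes J :: "('v::finite, 'k::comm_ring_1) mpoly set"
  assumes "ideal.subspace J" "graded J" "homogeneous e x" "e > 0"
    and "\<forall>f\<in>set fs. \<exists>d. homogeneous d f" "reg_on J (x # fs)"
  shows "reg_on J fs"
  using assms
proof (induction fs arbitrary: J)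
  case (Cons f fs)
  note J = Cons.prems(1)
  note x = reg_on_ConsD(1)[OF Cons.prems(6)]
  note f = reg_on_ConsD(1)[OF reg_on_ConsD(2)[OF Cons.prems(6)]]
  have freg: "g \<in> J" if g: "f * g \<in> J" for g
  proof (rule graded_separated[OF Cons.prems(2-4)])
    fix k
    show "\<exists>h. g - x ^ k * h \<in> J"
    proof (induction k)
      case 0 show ?case by (rule exI[of _ g]) (simp add: ideal.subspace_0[OF J])
    next
      case (Suc k)
      then obtain h where h: "g - x ^ k * h \<in> J" by blast
      have "f * g - f * (g - x ^ k * h) \<in> J"
        by (rule ideal.subspace_diff[OF J g ideal.subspace_scale[OF J h]])
      hence fh: "x ^ k * (f * h) \<in> J" by (rule mem_eqI) (simp add: algebra_simps)
      have "u \<in> J" if "x ^ k * u \<in> J" for u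
        using that by (induction k) (auto simp: mult.assoc dest!: x)
      hence "f * h \<in> J" using fh by blast
      hence "f * h \<in> ideal_gen (insert x J)" by (simp add: ideal_gen_def ideal.span_base)
      from f[OF this] obtain l where l: "h - l * x \<in> J" by (auto simp: in_ideal_gen_insert[OF J])
      have "(g - x ^ k * h) + x ^ k * (h - l * x) \<in> J"
        by (rule ideal.subspace_add[OF J h ideal.subspace_scale[OF J l]])
      hence "g - x ^ Suc k * l \<in> J" by (rule mem_eqI) (simp add: algebra_simps)
      thus ?case by blast
    qed
  qed
  have xreg: "g \<in> ideal_gen (insert f J)" if g: "x * g \<in> ideal_gen (insert f J)" for g
  proof -
    obtain h where h: "x * g - h * f \<in> J" using g by (auto simp: in_ideal_gen_insert[OF J])
    have "f * h - g * x \<in> J"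
      by (rule mem_eqI[OF ideal.subspace_neg[OF J h]]) (simp add: algebra_simps)
    hence "f * h \<in> ideal_gen (insert x J)" by (auto simp: in_ideal_gen_insert[OF J])
    from f[OF this] obtain l where l: "h - l * x \<in> J" by (auto simp: in_ideal_gen_insert[OF J])
    have "(x * g - h * f) + f * (h - l * x) \<in> J"
      by (rule ideal.subspace_add[OF J h ideal.subspace_scale[OF J l]])
    hence "x * (g - l * f) \<in> J" by (rule mem_eqI) (simp add: algebra_simps)
    from x[OF this] show ?thesis by (auto simp: in_ideal_gen_insert[OF J])
  qed
  obtain d where d: "homogeneous d f" using Cons.prems(5) by auto
  have "reg_on (ideal_gen (insert f J)) (x # fs)"
    using xreg reg_on_ConsD(2)[OF reg_on_ConsD(2)[OF Cons.prems(6)]]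
    unfolding ideal_gen_insert_commute[of f x] by (rule reg_on_ConsI)
  with Cons.prems(3-5) have "reg_on (ideal_gen (insert f J)) fs"
    by (intro Cons.IH[OF ideal_ideal_gen graded_ideal_gen_insert[OF J Cons.prems(2) d]]) auto
  with freg show ?case by (rule reg_on_ConsI)
qed simp

section \<open>Elementary symmetric polynomials as a universal regular sequence\<close>

definition esym :: "nat \<Rightarrow> ('v::finite, 'k::comm_ring_1) mpoly" where
  "esym k = (\<Sum>S | card S = k. \<Prod>v\<in>S. Var v)"

text \<open>
  The order is descending, from \<open>e\<^sub>d\<close> to \<open>e\<^sub>1\<close>, because on exactly \<open>d\<close> variables the first element is then
  a product of variables.
\<close>

primrec esyms :: "nat \<Rightarrow> ('v::finite, 'k::comm_ring_1) mpoly list" where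
  "esyms 0 = []"
| "esyms (Suc d) = esym (Suc d) # esyms d"

lemma length_esyms [simp]: "length (esyms d) = d"
  by (induction d) auto

lemma homogeneous_esym: "homogeneous k (esym k)"
  unfolding esym_def prod_Var
  by (intro homogeneous_sum homogeneous_single) (simp add: mon_degree_squarefree_mon)

lemma homogeneous_esyms: "f \<in> set (esyms d) \<Longrightarrow> \<exists>k>0. homogeneous k f"
  by (induction d) (auto intro: homogeneous_esym)

lemma esym_mod_simplex:
  "esym (card F) - (\<Prod>v\<in>F. Var v) \<in> (sr_ideal (Pow F) :: ('v::finite, 'k::comm_ring_1) mpoly set)"
proof -
  have J: "ideal.subspace (sr_ideal (Pow F) :: ('v, 'k) mpoly set)"
    by (rule ideal_sr_ideal) (auto simp: down_closed_def)
  have "{S. card S = card F} = insert F {S. card S = card F \<and> S \<noteq> F}" by auto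
  hence "esym (card F) - (\<Prod>v\<in>F. Var v :: ('v, 'k) mpoly)
      = (\<Sum>S | card S = card F \<and> S \<noteq> F. \<Prod>v\<in>S. Var v)"
    by (simp add: esym_def)
  also have "\<dots> \<in> sr_ideal (Pow F)"
    by (rule ideal.subspace_sum[OF J])
      (auto simp: prod_Var intro!: single_in_sr_ideal dest: card_subset_eq[rotated])
  finally show ?thesis .
qed

text \<open>
  Modulo the ideal of a simplex \<open>F\<close> only the variables in \<open>F\<close> matter. If \<open>|F| = d\<close>, then \<open>e\<^sub>d\<close> becomes the
  product of these variables and may be replaced by each factor in turn; setting that variable to
  zero leaves \<open>d - 1\<close> variables and \<open>e\<^sub>d\<^sub>-\<^sub>1, \<dots>, e\<^sub>1\<close>. If \<open>|F| > d\<close>, then \<open>x, e\<^sub>d, \<dots>, e\<^sub>1\<close> is regular for any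
  \<open>x \<in> F\<close> by induction on \<open>|F|\<close>, and \<open>x\<close> can be dropped.
\<close>

lemma reg_on_simplex_esyms:
  "d \<le> card F \<Longrightarrow> reg_on (sr_ideal (Pow F) :: ('v::finite, 'k::comm_ring_1) mpoly set) (esyms d)"
proof (induction "card F" arbitrary: F d)
  case (Suc n)
  have dc: "down_closed (Pow F)" by (auto simp: down_closed_def)
  note J = ideal_sr_ideal[OF dc, where 'k = 'k]
  have Var: "reg_on (sr_ideal (Pow F) :: ('v, 'k) mpoly set) (Var x # esyms d')"
    if x: "x \<in> F" and d': "d' \<le> n" for x d'
  proof (rule reg_on_ConsI)
    have "{S. insert x S \<in> Pow F} = Pow F" using x by auto
    thus "g \<in> sr_ideal (Pow F)" if "Var x * g \<in> sr_ideal (Pow F)" for g :: "('v, 'k) mpoly"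
      using that sr_ideal_colon[of x "Pow F"] by auto
    have "{S \<in> Pow F. x \<notin> S} = Pow (F - {x})" by auto
    moreover have "n = card (F - {x})" using Suc.hyps(2) x by simp
    ultimately show "reg_on (ideal_gen (insert (Var x) (sr_ideal (Pow F) :: ('v, 'k) mpoly set))) (esyms d')"
      unfolding sr_ideal_sum[OF dc] using Suc.hyps(1)[of "F - {x}" d'] d' by simp
  qed
  obtain x where x: "x \<in> F" using Suc.hyps(2) by fastforce
  show ?case
  proof (cases "d = Suc n")
    case True
    have "reg_on (sr_ideal (Pow F) :: ('v, 'k) mpoly set) ((\<Prod>v\<in>F. Var v) # esyms n)"
      using x by (intro reg_on_prod[OF J] Var) auto
    from reg_on_Cons_cong[OF J esym_mod_simplex this] show ?thesis
      by (simp add: True Suc.hyps(2)[symmetric])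
  next
    case False
    with Suc have "d \<le> n" by simp
    have "homogeneous 1 (Var x :: ('v, 'k) mpoly)"
      unfolding Var_def by (rule homogeneous_single) (simp add: mon_degree_def lookup_single when_def)
    moreover have "\<forall>f\<in>set (esyms d :: ('v, 'k) mpoly list). \<exists>k. homogeneous k f"
      using homogeneous_esyms by blast
    ultimately show ?thesis
      using reg_on_drop[OF J graded_sr_ideal _ zero_less_one _ Var[OF x \<open>d \<le> n\<close>]] by blast
  qed
qed simp

section \<open>Decomposable complexes and the lower bound for the depth\<close>

text \<open>
  A nonpure relative of vertex decomposability that records only a lower bound \<open>d\<close> on the size of the
  simplices at which the decomposition ends. Stars stay on the full vertex set, so a vertex that
  has been taken counts as a vertex of the simplex. The family without any face, which arises as
  the star of a vertex that lies in no face, is admitted.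
\<close>

inductive decomposable :: "nat \<Rightarrow> 'v::finite set set \<Rightarrow> bool" for d where
  simplex: "d \<le> card F \<Longrightarrow> decomposable d (Pow F)"
| void: "decomposable d {}"
| shed: "decomposable d {S. insert v S \<in> \<Delta>} \<Longrightarrow> decomposable d {S\<in>\<Delta>. v \<notin> S} \<Longrightarrow> decomposable d \<Delta>"

lemma reg_on_decomposable:
  assumes "decomposable d \<Delta>" "down_closed \<Delta>"
  shows "reg_on (sr_ideal \<Delta> :: ('v::finite, 'k::comm_ring_1) mpoly set) (esyms d)"
  using assms
proof induction
  case (simplex F)
  thus ?case by (intro reg_on_simplex_esyms)
next
  case void
  have "reg_on UNIV fs" for fs :: "('v, 'k) mpoly list"
    by (induction fs) (auto intro!: reg_on_ConsI simp: ideal_gen_def)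
  thus ?case by (simp add: sr_ideal_def)
next
  case (shed v \<Delta>)
  have "down_closed {S. insert v S \<in> \<Delta>}" "down_closed {S\<in>\<Delta>. v \<notin> S}"
    using shed.prems unfolding down_closed_def by (blast intro: insert_mono)+
  with shed show ?case
    by (intro reg_on_colon_sum[OF ideal_sr_ideal[OF shed.prems], where x = "Var v"])
      (simp_all add: sr_ideal_colon sr_ideal_sum)
qed

lemma irrelevant_ideal_eq: "irrelevant_ideal = (sr_ideal {{}} :: ('v, 'k::comm_ring_1) mpoly set)"
proof
  show "irrelevant_ideal \<subseteq> (sr_ideal {{}} :: ('v, 'k) mpoly set)"
    unfolding irrelevant_ideal_def ideal_gen_def
    by (intro ideal.span_minimal ideal_sr_ideal)
      (auto simp: sr_ideal_def Var_def down_closed_def simp del: keys_eq_empty)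
  show "(sr_ideal {{}} :: ('v, 'k) mpoly set) \<subseteq> irrelevant_ideal"
  proof
    fix p :: "('v, 'k) mpoly" assume p: "p \<in> sr_ideal {{}}"
    have "single m (lookup p m) \<in> irrelevant_ideal"
      if m: "m \<in> keys p" for m
    proof -
      obtain v where v: "v \<in> keys m" 
        using p m by (auto simp: sr_ideal_def simp del: keys_eq_empty)
      obtain h where "keys (single m (lookup p m) - h * Var v) \<subseteq>
          {k \<in> keys (single m (lookup p m)). v \<notin> keys k}"
        by (rule Var_dvd_split)
      hence "keys (single m (lookup p m) - h * Var v) = {}"
        using v by (auto simp del: keys_eq_empty split: if_splits)
      hence "single m (lookup p m) = h * Var v" by simp
      thus ?thesis by (simp add: irrelevant_ideal_def ideal_gen_def ideal.span_scale ideal.span_base)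
    qed
    hence "(\<Sum>m\<in>keys p. single m (lookup p m)) \<in> irrelevant_ideal"
      unfolding irrelevant_ideal_def ideal_gen_def by (intro ideal.span_sum)
    thus "p \<in> irrelevant_ideal" by (simp flip: poly_sum_terms)
  qed
qed

theorem depth_ge_decomposable:
  assumes "decomposable d \<Delta>" "down_closed \<Delta>" "{} \<in> \<Delta>"
  shows "enat d \<le> depth_mod (sr_ideal \<Delta> :: ('v::finite, 'k::comm_ring_1) mpoly set)"
proof -
  let ?J = "sr_ideal \<Delta> :: ('v, 'k) mpoly set"
  have J: "ideal.subspace ?J" by (rule ideal_sr_ideal) fact
  have irr: "set (esyms d) \<subseteq> (irrelevant_ideal :: ('v, 'k) mpoly set)"
    using homogeneous_esyms
    by (fastforce simp: irrelevant_ideal_eq sr_ideal_def homogeneous_def mon_degree_def in_keys_iff)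
  have "?J \<subseteq> irrelevant_ideal" using assms(3) by (auto simp: irrelevant_ideal_eq sr_ideal_def)
  with irr have "ideal_gen (?J \<union> set (esyms d)) \<subseteq> irrelevant_ideal"
    unfolding ideal_gen_def
    by (intro ideal.span_minimal) (auto simp: irrelevant_ideal_def ideal_ideal_gen)
  moreover have "(1 :: ('v, 'k) mpoly) \<notin> irrelevant_ideal"
    by (simp add: irrelevant_ideal_eq sr_ideal_def)
  ultimately have "regular_sequence_mod ?J (esyms d)"
    using reg_on_decomposable[OF assms(1,2), where 'k = 'k] by (auto simp: regular_sequence_mod_iff[OF J])
  with irr show ?thesis
    unfolding depth_mod_def by (intro Sup_upper) (auto intro!: exI[of _ "esyms d"])
qed

section \<open>Facets and the upper bound for the depth\<close>

text \<open>
  If \<open>\<Phi>\<close> is a polynomial in \<open>T\<^sub>1, \<dots>, T\<^sub>r\<close>, not zero, and \<open>T\<^sub>1\<^sup>j\<close> is the highest power of \<open>T\<^sub>1\<close> dividing it,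
  then \<open>\<Phi> = T\<^sub>1\<^sup>j (\<Psi> + T\<^sub>1 \<Theta>)\<close> where \<open>\<Psi>\<close> is a polynomial in \<open>T\<^sub>2, \<dots>, T\<^sub>r\<close> and not zero. The recursion keeps
  this shape for the value of \<open>\<Phi>\<close> at \<open>f\<^sub>1, \<dots>, f\<^sub>r\<close> and lets the value of \<open>\<Theta>\<close> be arbitrary; \<open>U\<close> is the set
  of admissible lowest coefficients.
\<close>

fun combos :: "'r::comm_ring_1 set \<Rightarrow> 'r list \<Rightarrow> 'r set" where
  "combos U [] = U"
| "combos U (f # fs) = {f ^ j * (p + f * h) | j p h. p \<in> combos U fs}"

text \<open>
  Since \<open>f\<^sub>1\<close> is regular, the factor \<open>f\<^sub>1\<^sup>j\<close> can be cancelled. Modulo \<open>f\<^sub>1\<close> the term with \<open>f\<^sub>1 h\<close> disappears,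
  and what remains is a combination of the shorter sequence.
\<close>

lemma combos_annihilate:
  fixes J :: "'r::comm_ring_1 set"
  assumes "ideal.subspace J" "reg_on J fs" "p \<in> combos U fs" "\<forall>c\<in>U. c dvd 1" "p * g \<in> J"
  shows "g \<in> ideal_gen (J \<union> set fs)"
  using assms
proof (induction fs arbitrary: J p)
  case Nil
  then obtain d where "1 = p * d" by (auto simp: dvd_def)
  hence "g = d * (p * g)" by (metis mult.commute mult.left_commute mult.right_neutral)
  with Nil show ?case by (metis Un_empty_right ideal.subspace_scale ideal_gen_ideal list.set(1))
next
  case (Cons f fs)
  note J = Cons.prems(1)
  obtain j p' h where p: "p = f ^ j * (p' + f * h)" and p': "p' \<in> combos U fs"
    using Cons.prems(3) by auto
  have "u \<in> J" if "f ^ j * u \<in> J" for u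
    using that
  proof (induction j)
    case (Suc j)
    from Suc.prems have "f * (f ^ j * u) \<in> J" by (simp add: mult.assoc)
    from Suc.IH[OF reg_on_ConsD(1)[OF Cons.prems(2) this]] show ?case .
  qed simp
  moreover have "f ^ j * ((p' + f * h) * g) \<in> J" using Cons.prems(5) by (simp add: p mult.assoc)
  ultimately have "(p' + f * h) * g \<in> J" by blast
  hence "p' * g \<in> ideal_gen (insert f J)"
    unfolding in_ideal_gen_insert[OF J]
    by (intro exI[of _ "- h * g"]) (erule mem_eqI, simp add: algebra_simps)
  from Cons.IH[OF ideal_ideal_gen reg_on_ConsD(2)[OF Cons.prems(2)] p' Cons.prems(4) this]
  show ?case by (simp add: ideal_gen_ideal_gen_Un)
qed

definition pows :: "'r::comm_ring_1 list \<Rightarrow> nat list \<Rightarrow> 'r" where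
  "pows fs as = prod_list (map2 (^) fs as)"

lemma polynomial_combo:
  fixes c :: "nat list \<Rightarrow> 'r::comm_ring_1"
  assumes "finite A" "A \<noteq> {}" "\<And>as. as \<in> A \<Longrightarrow> length as = length fs" "\<And>as. as \<in> A \<Longrightarrow> c as \<in> U"
  shows "(\<Sum>as\<in>A. c as * pows fs as) \<in> combos U fs"
  using assms
proof (induction fs arbitrary: A c)
  case Nil
  hence "A = {[]}" by auto
  with Nil show ?case by (simp add: pows_def)
next
  case (Cons f fs)
  define j where "j = Min (hd ` A)"
  define A0 where "A0 = {bs. j # bs \<in> A}"
  define A1 where "A1 = {as \<in> A. hd as \<noteq> j}"
  have len: "length as = Suc (length fs)" if "as \<in> A" for as using Cons.prems(3) that by simp
  have "j \<in> hd ` A" unfolding j_def by (rule Min_in) (use Cons.prems in auto)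
  then obtain as where as: "as \<in> A" "hd as = j" by auto
  with len[of as] have "tl as \<in> A0" by (cases as) (auto simp: A0_def)
  hence A0_ne: "A0 \<noteq> {}" by auto
  have part: "A = (#) j ` A0 \<union> A1"
  proof -
    have "as \<in> (#) j ` A0" if "as \<in> A" "hd as = j" for as
      using that len[of as] by (cases as) (auto simp: A0_def)
    thus ?thesis by (auto simp: A0_def A1_def)
  qed
  have fin: "finite A0"
    using Cons.prems(1) unfolding part by (metis finite_Un finite_imageD inj_onI list.inject)
  have disj: "(#) j ` A0 \<inter> A1 = {}" by (auto simp: A1_def)
  have 0: "(\<Sum>as\<in>(#) j ` A0. c as * pows (f # fs) as)
      = f ^ j * (\<Sum>bs\<in>A0. c (j # bs) * pows fs bs)"
    by (simp add: sum.reindex pows_def sum_distrib_left algebra_simps)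
  have 1: "(\<Sum>as\<in>A1. c as * pows (f # fs) as)
      = f ^ j * (f * (\<Sum>as\<in>A1. c as * f ^ (hd as - j - 1) * pows fs (tl as)))"
    unfolding sum_distrib_left
  proof (rule sum.cong[OF refl])
    fix as assume as: "as \<in> A1"
    have "j \<le> hd as" unfolding j_def by (rule Min_le) (use Cons.prems as in \<open>auto simp: A1_def\<close>)
    with as have "hd as = j + (1 + (hd as - j - 1))" by (auto simp: A1_def)
    hence p: "f ^ hd as = f ^ j * (f * f ^ (hd as - j - 1))" by (metis power_add power_one_right)
    obtain a bs where "as = a # bs" using len[of as] as by (cases as) (auto simp: A1_def)
    with p show "c as * pows (f # fs) as
        = f ^ j * (f * (c as * f ^ (hd as - j - 1) * pows fs (tl as)))"
      by (simp add: pows_def algebra_simps)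
  qed
  have "(\<Sum>bs\<in>A0. c (j # bs) * pows fs bs) \<in> combos U fs"
  proof (rule Cons.IH[OF fin A0_ne])
    fix bs assume "bs \<in> A0"
    hence "j # bs \<in> A" by (simp add: A0_def)
    thus "length bs = length fs" "c (j # bs) \<in> U" using len Cons.prems(4) by fastforce+
  qed
  moreover have "(\<Sum>as\<in>A. c as * pows (f # fs) as) = f ^ j * ((\<Sum>bs\<in>A0. c (j # bs) * pows fs bs)
      + f * (\<Sum>as\<in>A1. c as * f ^ (hd as - j - 1) * pows fs (tl as)))"
  proof -
    have "finite A1" using Cons.prems(1) by (simp add: A1_def)
    with fin show ?thesis
      by (subst part, subst sum.union_disjoint) (simp_all only: finite_imageI disj 0 1 distrib_left)
  qed
  ultimately show ?case by auto
qed

lemma linear_system_nontrivial: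
  fixes f :: "'a \<Rightarrow> 'b \<Rightarrow> 'k::field"
  assumes "finite B" "finite A" "card B < card A"
  shows "\<exists>c. (\<exists>a\<in>A. c a \<noteq> 0) \<and> (\<forall>b\<in>B. (\<Sum>a\<in>A. c a * f a b) = 0)"
  using assms
proof (induction B arbitrary: A f rule: finite_induct)
  case empty
  hence "A \<noteq> {}" by auto
  thus ?case by (intro exI[of _ "\<lambda>_. 1"]) auto
next
  case (insert b B)
  show ?case
  proof (cases "\<forall>a\<in>A. f a b = 0")
    case True
    have "card B < card A" using insert by simp
    from insert.IH[OF insert.prems(1) this]
    obtain c where "\<exists>a\<in>A. c a \<noteq> 0" "\<forall>b\<in>B. (\<Sum>a\<in>A. c a * f a b) = 0"
      by blast
    with True show ?thesis by (intro exI[of _ c]) auto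
  next
    case False
    then obtain z where z: "z \<in> A" "f z b \<noteq> 0" by auto
    \<comment> \<open>Gaussian elimination with pivot \<open>z\<close> in the equation \<open>b\<close>.\<close>
    define g where "g a b' = f a b' - f a b / f z b * f z b'" for a b'
    have "card B < card (A - {z})" using insert z by simp
    from insert.IH[OF finite_Diff[OF insert.prems(1)] this, of g]
    obtain c where c: "\<exists>a\<in>A - {z}. c a \<noteq> 0"
      "\<forall>b'\<in>B. (\<Sum>a\<in>A - {z}. c a * g a b') = 0"
      by blast
    define d where "d = - (\<Sum>a\<in>A - {z}. c a * f a b) / f z b"
    have split: "(\<Sum>a\<in>A. (c(z := d)) a * f a b') = d * f z b' + (\<Sum>a\<in>A - {z}. c a * f a b')" for b'
      using insert.prems z by (subst sum.remove[of _ z]) (auto intro!: sum.cong)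
    have "(\<Sum>a\<in>A. (c(z := d)) a * f a b') = (\<Sum>a\<in>A - {z}. c a * g a b')" for b'
      unfolding split unfolding d_def g_def
      by (simp add: sum_divide_distrib sum_distrib_right sum_negf sum_subtractf right_diff_distrib mult.assoc)
    moreover have "(\<Sum>a\<in>A - {z}. c a * g a b) = 0" using z by (simp add: g_def)
    ultimately have "\<forall>b'\<in>insert b B. (\<Sum>a\<in>A. (c(z := d)) a * f a b') = 0" using c by simp
    moreover have "\<exists>a\<in>A. (c(z := d)) a \<noteq> 0" using c by auto
    ultimately show ?thesis by blast
  qed
qed

lemma mon_degree_power_le:
  fixes f :: "('v::finite, 'k::comm_ring_1) mpoly"
  assumes "\<And>m. m \<in> keys f \<Longrightarrow> mon_degree m \<le> e" "m \<in> keys (f ^ a)"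
  shows "mon_degree m \<le> a * e"
  using assms(2)
proof (induction a arbitrary: m)
  case 0
  thus ?case by (simp add: mon_degree_def)
next
  case (Suc a)
  then obtain k l where "m = k + l" "k \<in> keys f" "l \<in> keys (f ^ a)"
    using keys_mult[of f "f ^ a"] by auto
  with Suc.IH[of l] assms(1)[of k] show ?case by (simp add: mon_degree_add)
qed

lemma mon_degree_pows_le:
  fixes fs :: "('v::finite, 'k::comm_ring_1) mpoly list"
  assumes "\<forall>f\<in>set fs. \<forall>m\<in>keys f. mon_degree m \<le> e"
    and "set as \<subseteq> {..D}" "m \<in> keys (pows fs as)"
  shows "mon_degree m \<le> length fs * (D * e)"
  using assms
proof (induction fs arbitrary: as m)
  case Nil
  thus ?case by (simp add: pows_def mon_degree_def)
next
  case (Cons f fs)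
  show ?case
  proof (cases as)
    case Nil
    with Cons.prems show ?thesis by (simp add: pows_def mon_degree_def)
  next
    case as: (Cons a as')
    with Cons.prems obtain k l where m: "m = k + l" and k: "k \<in> keys (f ^ a)"
      and l: "l \<in> keys (pows fs as')"
      using keys_mult[of "f ^ a" "pows fs as'"] by (auto simp: pows_def)
    have "mon_degree k \<le> a * e" using Cons.prems(1) k by (intro mon_degree_power_le) auto
    also have "\<dots> \<le> D * e" using Cons.prems(2) as by simp
    finally show ?thesis using Cons.IH[of as' l] Cons.prems as l by (simp add: m mon_degree_add)
  qed
qed

lemma card_bounded_monomials:
  fixes W :: "'v::finite set"
  shows "finite {m :: 'v \<Rightarrow>\<^sub>0 nat. keys m \<subseteq> W \<and> (\<forall>v. lookup m v \<le> N)}"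
    and "card {m :: 'v \<Rightarrow>\<^sub>0 nat. keys m \<subseteq> W \<and> (\<forall>v. lookup m v \<le> N)} \<le> Suc N ^ card W"
proof -
  let ?B = "{m :: 'v \<Rightarrow>\<^sub>0 nat. keys m \<subseteq> W \<and> (\<forall>v. lookup m v \<le> N)}"
  let ?P = "W \<rightarrow>\<^sub>E {..N}"
  have inj: "inj_on (\<lambda>m. restrict (lookup m) W) ?B"
  proof (rule inj_onI)
    fix m k assume mk: "m \<in> ?B" "k \<in> ?B"
      "restrict (lookup m) W = restrict (lookup k) W"
    show "m = k"
    proof (rule poly_mapping_eqI)
      fix v
      show "lookup m v = lookup k v"
      proof (cases "v \<in> W")
        case True
        thus ?thesis using fun_cong[OF mk(3), of v] by simp
      next
        case False
        hence "v \<notin> keys m" "v \<notin> keys k" using mk(1,2) by auto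
        thus ?thesis by (simp add: in_keys_iff)
      qed
    qed
  qed
  have sub: "(\<lambda>m. restrict (lookup m) W) ` ?B \<subseteq> ?P" by auto
  have fin: "finite ?P" by (intro finite_PiE) auto
  show "finite ?B" using inj_on_finite[OF inj sub fin] .
  show "card ?B \<le> Suc N ^ card W"
    using card_inj_on_le[OF inj sub fin] by (simp add: card_PiE)
qed

text \<open>
  Polynomials in \<open>|W|\<close> variables are algebraically dependent if there are more than \<open>|W|\<close> of them. The
  coefficients of a relation are found by counting: the \<open>(D + 1)\<^sup>r\<close> products with exponents at most
  \<open>D\<close> have degree at most \<open>N = r D e\<close>, so modulo the other variables they involve at most
  \<open>(N + 1)\<^bsup>|W|\<^esup>\<close> monomials, which is less for large \<open>D\<close>.
\<close>

lemma exists_vanishing_combo: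
  fixes fs :: "('v::finite, 'k::field) mpoly list"
  assumes "card W < length fs"
  obtains p where "p \<in> combos {single 0 c | c. c \<noteq> 0} fs" "p \<in> sr_ideal (Pow W)"
proof -
  define r where "r = length fs"
  define e where "e = Max (insert 0 (mon_degree ` (\<Union>f\<in>set fs. keys f)))"
  have e: "\<forall>f\<in>set fs. \<forall>m\<in>keys f. mon_degree m \<le> e"
    by (auto simp: e_def intro!: Max_ge)
  \<comment> \<open>With this choice \<open>(N + 1)\<^bsup>|W|\<^esup> \<le> D (D + 1)\<^bsup>|W|\<^esup> < (D + 1)\<^sup>r\<close>.\<close>
  define D where "D = Suc (r * e) ^ card W"
  define N where "N = r * (D * e)"
  define A where "A = {as. set as \<subseteq> {..D} \<and> length as = r}"
  define B where "B = {m :: 'v \<Rightarrow>\<^sub>0 nat. keys m \<subseteq> W \<and> (\<forall>v. lookup m v \<le> N)}"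
  have "Suc N \<le> Suc (r * e) * Suc D" by (simp add: N_def algebra_simps)
  hence "Suc N ^ card W \<le> (Suc (r * e) * Suc D) ^ card W" by (rule power_mono) simp
  also have "\<dots> = D * Suc D ^ card W" by (simp only: power_mult_distrib D_def)
  also have "\<dots> < Suc D ^ Suc (card W)" by simp
  also have "\<dots> \<le> Suc D ^ r" using assms by (intro power_increasing) (auto simp: r_def)
  also have "\<dots> = card A" unfolding A_def by (subst card_lists_length_eq) auto
  finally have "card B < card A"
    using card_bounded_monomials(2)[of W N] by (simp add: B_def)
  moreover have "finite A" unfolding A_def by (rule finite_lists_length_eq) simp
  moreover have "finite B" unfolding B_def by (rule card_bounded_monomials)
  ultimately obtain c where c: "\<exists>as\<in>A. c as \<noteq> 0"
      "\<forall>m\<in>B. (\<Sum>as\<in>A. c as * lookup (pows fs as) m) = 0"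
    using linear_system_nontrivial[of B A "\<lambda>as. lookup (pows fs as)"] by blast
  define A' where "A' = {as \<in> A. c as \<noteq> 0}"
  define p where "p = (\<Sum>as\<in>A'. single 0 (c as) * pows fs as)"
  have "p \<in> combos {single 0 c | c. c \<noteq> 0} fs"
    unfolding p_def
  proof (rule polynomial_combo)
    show "finite A'" using \<open>finite A\<close> by (simp add: A'_def)
    show "A' \<noteq> {}" using c(1) by (auto simp: A'_def)
  qed (auto simp: A'_def A_def r_def)
  moreover have "p \<in> sr_ideal (Pow W)"
    unfolding sr_ideal_def
  proof safe
    fix m assume m: "m \<in> keys p" "keys m \<subseteq> W"
    have "lookup p m = (\<Sum>as\<in>A'. c as * lookup (pows fs as) m)"
      by (simp add: p_def lookup_sum lookup_monomial_mult[of 0 _ _ m, simplified])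
    also have "\<dots> = (\<Sum>as\<in>A. c as * lookup (pows fs as) m)"
      by (rule sum.mono_neutral_left) (auto simp: A'_def \<open>finite A\<close>)
    also have "\<dots> = 0"
    proof (cases "m \<in> B")
      case True
      thus ?thesis using c(2) by blast
    next
      case False
      then obtain v where "N < lookup m v" using m(2) by (auto simp: B_def not_le)
      also have "\<dots> \<le> mon_degree m" unfolding mon_degree_def by (rule member_le_sum) auto
      finally have "lookup (pows fs as) m = 0" if "as \<in> A" for as
        using mon_degree_pows_le[OF e, of as D m] that
        by (force simp: A_def N_def r_def in_keys_iff)
      thus ?thesis by (simp add: sum.neutral)
    qed
    finally show False using m(1) by (simp add: in_keys_iff)
  qed
  ultimately show ?thesis by (rule that)
qed

theorem depth_le_facet:
  fixes \<Delta> :: "'v::finite set set"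
  assumes "down_closed \<Delta>" "W \<in> \<Delta>" and facet: "\<And>v. v \<notin> W \<Longrightarrow> insert v W \<notin> \<Delta>"
  shows "depth_mod (sr_ideal \<Delta> :: ('v, 'k::field) mpoly set) \<le> enat (card W)"
  unfolding depth_mod_def
proof (rule Sup_least, safe)
  let ?J = "sr_ideal \<Delta> :: ('v, 'k) mpoly set"
  note J = ideal_sr_ideal[OF assms(1), where 'k = 'k]
  fix fs :: "('v, 'k) mpoly list"
  assume irr: "set fs \<subseteq> irrelevant_ideal" and reg: "regular_sequence_mod ?J fs"
  show "enat (length fs) \<le> enat (card W)"
  proof (rule ccontr)
    assume "\<not> enat (length fs) \<le> enat (card W)"
    hence long: "card W < length fs" by simp
    \<comment> \<open>One more than the degree of the product of the variables in \<open>W\<close>.\<close>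
    define t where "t = Suc (card W)"
    define fs' where "fs' = map (\<lambda>f. f ^ t) fs"
    have reg': "reg_on ?J fs'"
      using reg unfolding fs'_def regular_sequence_mod_iff[OF J] by (intro reg_on_powers[OF J]) (auto simp: t_def)
    define u :: "('v, 'k) mpoly" where "u = single (squarefree_mon W) 1"
    obtain p where p: "p \<in> combos {single 0 c | c. c \<noteq> 0} fs'" "p \<in> sr_ideal (Pow W)"
      using exists_vanishing_combo[of W fs'] long by (auto simp: fs'_def)
    have "p * u \<in> ?J"
      unfolding sr_ideal_def
    proof safe
      fix m assume m: "m \<in> keys (p * u)" "keys m \<in> \<Delta>"
      then obtain k where k: "k \<in> keys p" "m = k + squarefree_mon W"
        using keys_mult[of p u] by (auto simp: u_def)
      then obtain v where "v \<in> keys k" "v \<notin> W" using p(2) by (auto simp: sr_ideal_def)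
      with k have "insert v W \<subseteq> keys m" by (auto simp: keys_add_nat)
      with m(2) assms(1) have "insert v W \<in> \<Delta>" unfolding down_closed_def by blast
      with facet \<open>v \<notin> W\<close> show False by blast
    qed
    moreover have "\<forall>c\<in>{single 0 c | c. c \<noteq> 0}. c dvd (1 :: ('v, 'k) mpoly)"
    proof safe
      fix c :: 'k assume "c \<noteq> 0"
      hence "(1 :: ('v, 'k) mpoly) = single 0 c * single 0 (inverse c)"
        by (simp add: mult_single)
      thus "single 0 c dvd (1 :: ('v, 'k) mpoly)" by (rule dvdI)
    qed
    ultimately have u_in: "u \<in> ideal_gen (?J \<union> set fs')"
      by (intro combos_annihilate[OF J reg' p(1)])
    \<comment> \<open>An ideal that contains \<open>J\<close> and the powers \<open>f\<^sup>t\<close>, but not \<open>u\<close>.\<close>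
    define Q where "Q = {p :: ('v, 'k) mpoly. keys p \<subseteq> {m. keys m \<notin> \<Delta> \<or> t \<le> mon_degree m}}"
    have "ideal.subspace Q"
      unfolding Q_def
      by (rule monomial_ideal) (use assms(1) in \<open>auto simp: keys_add_nat mon_degree_add down_closed_def\<close>)
    moreover have "f ^ t \<in> Q" if f: "f \<in> set fs" for f
    proof -
      have pos: "1 \<le> mon_degree m" if "m \<in> keys f" for m
      proof -
        have "keys m \<noteq> {}" using f irr that by (auto simp: irrelevant_ideal_eq sr_ideal_def simp del: keys_eq_empty)
        then obtain v where "v \<in> keys m" by blast
        hence "1 \<le> lookup m v" by (simp add: in_keys_iff)
        also have "\<dots> \<le> mon_degree m" unfolding mon_degree_def by (rule member_le_sum) auto
        finally show ?thesis .
      qed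
      have "s \<le> mon_degree m" if "m \<in> keys (f ^ s)" for s m
        using that
      proof (induction s arbitrary: m)
        case (Suc s)
        then obtain k l where "m = k + l" "k \<in> keys f" "l \<in> keys (f ^ s)"
          using keys_mult[of f "f ^ s"] by auto
        with Suc.IH[of l] pos[of k] show ?case by (simp add: mon_degree_add)
      qed simp
      thus ?thesis by (auto simp: Q_def)
    qed
    ultimately have "ideal_gen (?J \<union> set fs') \<subseteq> Q"
      unfolding ideal_gen_def fs'_def
      by (intro ideal.span_minimal) (auto simp: Q_def sr_ideal_def)
    with u_in have "u \<in> Q" by blast
    thus False using assms(2) by (simp add: Q_def u_def mon_degree_squarefree_mon t_def)
  qed
qed

section \<open>Matchings, cycles and forests\<close>

lemma card_disjoint_le:
  assumes "disjoint M" "finite Z" "\<And>e. e \<in> M \<Longrightarrow> e \<inter> Z \<noteq> {}"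
  shows "card M \<le> card Z"
proof -
  define f where "f e = (SOME z. z \<in> e \<inter> Z)" for e
  have f: "f e \<in> e \<inter> Z" if "e \<in> M" for e
    unfolding f_def some_in_eq by (rule assms(3)[OF that])
  have "inj_on f M"
  proof (rule inj_onI)
    fix a b assume "a \<in> M" "b \<in> M" "f a = f b"
    hence "a \<inter> b \<noteq> {}" using f[of a] f[of b] by auto
    with \<open>a \<in> M\<close> \<open>b \<in> M\<close> assms(1) show "a = b" by (auto simp: disjoint_def)
  qed
  moreover have "f ` M \<subseteq> Z" using f by auto
  ultimately show ?thesis using assms(2) by (rule card_inj_on_le)
qed

lemma matching_subset: "matching E M \<Longrightarrow> N \<subseteq> M \<Longrightarrow> matching E N"
  using pairwise_subset[of disjnt M N] by (simp add: matching_def subset_trans)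

lemma card_matching_le:
  assumes "matching E M" "finite Z"
  shows "card M \<le> card Z + card {e \<in> M. e \<inter> Z = {}}"
proof -
  have "card {e \<in> M. e \<inter> Z \<noteq> {}} \<le> card Z"
    by (rule card_disjoint_le[OF _ assms(2)]) (use assms(1) in \<open>auto simp: matching_def disjoint_def\<close>)
  moreover have "card M = card {e \<in> M. e \<inter> Z \<noteq> {}} + card {e \<in> M. e \<inter> Z = {}}"
    by (subst card_Un_disjoint[symmetric]) (auto intro: arg_cong[where f = card])
  ultimately show ?thesis by simp
qed

lemma matching_insert:
  assumes "matching E M" "e \<in> E" "e \<inter> \<Union>M = {}" "e \<noteq> {}"
  shows "matching E (insert e M)" "card (insert e M) = Suc (card M)"
proof -
  show "matching E (insert e M)"
    unfolding matching_def
  proof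
    show "insert e M \<subseteq> E" using assms(1,2) by (simp add: matching_def)
    have "disjnt e f" "disjnt f e" if "f \<in> M" for f
      using that assms(3) unfolding disjnt_def by blast+
    thus "disjoint (insert e M)"
      using assms(1) unfolding matching_def by (simp add: pairwise_insert)
  qed
  have "e \<notin> M"
  proof
    assume "e \<in> M"
    hence "e \<subseteq> \<Union>M" by blast
    with assms(3,4) show False by blast
  qed
  thus "card (insert e M) = Suc (card M)" by simp
qed

lemma edge_nonempty: "simple_graph H \<Longrightarrow> e \<in> H \<Longrightarrow> e \<noteq> {}"
  by (auto simp: simple_graph_def)

text \<open>
  The offset \<open>a\<close> serves for odd cycles: leaving out one vertex of such a cycle, put at the beginning by
  a rotation, the others are matched perfectly.
\<close>

lemma path_matching:
  fixes c :: "'a::finite list"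
  assumes "distinct c" "a + 2 * r \<le> length c"
    and "\<And>i. Suc i < length c \<Longrightarrow> {c ! i, c ! Suc i} \<in> H"
  obtains M where "matching H M" "card M = r" "\<Union>M \<subseteq> set (drop a c)"
proof -
  define e where "e k = {c ! (a + 2 * k), c ! Suc (a + 2 * k)}" for k
  have disj: "e k \<inter> e l = {}" if "k < r" "l < r" "k \<noteq> l" for k l
    using that assms(1,2) by (auto simp: e_def nth_eq_iff_index_eq)
  have "inj_on e {..<r}"
  proof (rule inj_onI)
    fix k l assume "k \<in> {..<r}" "l \<in> {..<r}" "e k = e l"
    thus "k = l" using disj[of k l] by (auto simp: e_def)
  qed
  hence "card (e ` {..<r}) = r" by (simp add: card_image)
  moreover have "matching H (e ` {..<r})"
    unfolding matching_def
  proof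
    show "e ` {..<r} \<subseteq> H" using assms(2,3) by (auto simp: e_def)
    show "disjoint (e ` {..<r})" using disj by (auto simp: disjoint_def)
  qed
  moreover have "\<Union>(e ` {..<r}) \<subseteq> set (drop a c)"
  proof -
    have "c ! (a + j) \<in> set (drop a c)" if "a + j < length c" for j
      using that by (auto simp: in_set_conv_nth intro!: exI[of _ j])
    from this[of "2 * _"] this[of "Suc (2 * _)"] show ?thesis using assms(2) by (auto simp: e_def)
  qed
  ultimately show ?thesis using that by blast
qed

lemma is_cycle_path: "is_cycle H c \<Longrightarrow> Suc i < length c \<Longrightarrow> {c ! i, c ! Suc i} \<in> H"
  unfolding is_cycle_def by (metis Suc_lessD mod_less)

lemma is_cycle_rotate:
  assumes "is_cycle H c"
  shows "is_cycle H (rotate i c)"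
  unfolding is_cycle_def
proof (intro conjI allI impI)
  fix k assume k: "k < length (rotate i c)"
  let ?m = "length c"
  have "?m > 0" using k by auto
  hence "{c ! ((i + k) mod ?m), c ! (Suc ((i + k) mod ?m) mod ?m)} \<in> H"
    using assms by (simp add: is_cycle_def)
  moreover have "Suc ((i + k) mod ?m) mod ?m = (i + Suc k mod ?m) mod ?m"
    by (simp add: mod_simps)
  ultimately show "{rotate i c ! k, rotate i c ! (Suc k mod length (rotate i c))} \<in> H"
    using k \<open>?m > 0\<close> by (simp add: nth_rotate)
qed (use assms in \<open>simp_all add: is_cycle_def\<close>)

text \<open>
  The end of a longest path has no neighbours outside the path, and a second neighbour on it would
  close a cycle. If \<open>v\<close> has no neighbour in \<open>U\<close>, then \<open>w\<close> is arbitrary.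
\<close>

lemma low_degree_vertex:
  fixes H :: "'a::finite set set"
  assumes H: "simple_graph H" and acyclic: "\<And>c. is_cycle H c \<Longrightarrow> \<not> set c \<subseteq> U" and "U \<noteq> {}"
  shows "\<exists>v\<in>U. \<exists>w. \<forall>e\<in>H. e \<subseteq> U \<longrightarrow> v \<in> e \<longrightarrow> e = {v, w}"
proof (rule ccontr)
  assume no: "\<not> ?thesis"
  have nbr: "\<exists>x\<in>U. {v, x} \<in> H \<and> x \<noteq> v \<and> x \<noteq> w" if "v \<in> U" for v w
  proof -
    obtain e where e: "e \<in> H" "e \<subseteq> U" "v \<in> e" "e \<noteq> {v, w}" using no \<open>v \<in> U\<close> by blast
    have "card e = 2" using H e(1) by (simp add: simple_graph_def)
    then obtain x where "e = {v, x}" "x \<noteq> v" using e(3) by (auto simp: card_2_iff doubleton_eq_iff)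
    with e show ?thesis by auto
  qed
  define P where "P p \<longleftrightarrow> distinct p \<and> p \<noteq> [] \<and> set p \<subseteq> U \<and>
    (\<forall>i. Suc i < length p \<longrightarrow> {p ! i, p ! Suc i} \<in> H)" for p
  obtain u where "u \<in> U" using \<open>U \<noteq> {}\<close> by blast
  hence "P [u]" by (simp add: P_def)
  moreover have "\<forall>p. P p \<longrightarrow> length p < Suc (card U)"
    by (auto simp: P_def less_Suc_eq_le distinct_card[symmetric] intro: card_mono)
  ultimately obtain p where p: "P p" and longest: "\<And>p'. P p' \<Longrightarrow> length p' \<le> length p"
    using ex_has_greatest_nat[of P "[u]" length "Suc (card U)"] by blast
  \<comment> \<open>On a path with one vertex the first vertex stands in for the missing second one.\<close>
  define w where "w = (if length p > 1 then p ! 1 else p ! 0)"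
  have "p ! 0 \<in> U" using p by (auto simp: P_def)
  then obtain x where x: "x \<in> U" "{p ! 0, x} \<in> H" "x \<noteq> p ! 0" "x \<noteq> w" using nbr by blast
  show False
  proof (cases "x \<in> set p")
    case False
    have "P (x # p)"
      unfolding P_def
    proof (intro conjI allI impI)
      fix i assume "Suc i < length (x # p)"
      with p x(2) show "{(x # p) ! i, (x # p) ! Suc i} \<in> H"
        by (cases i) (auto simp: P_def insert_commute)
    qed (use p x False in \<open>auto simp: P_def\<close>)
    from longest[OF this] show False by simp
  next
    case True
    then obtain j where j: "j < length p" "p ! j = x" by (auto simp: in_set_conv_nth)
    have "j \<noteq> 0" using j x(3) by metis
    moreover have "j \<noteq> 1" using j x(4) by (auto simp: w_def)
    ultimately have "2 \<le> j" by simp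
    have "is_cycle H (take (Suc j) p)"
      unfolding is_cycle_def
    proof (intro conjI allI impI)
      fix i assume i: "i < length (take (Suc j) p)"
      show "{take (Suc j) p ! i, take (Suc j) p ! (Suc i mod length (take (Suc j) p))} \<in> H"
      proof (cases "i = j")
        case True
        thus ?thesis using j x(2) by (simp add: insert_commute)
      next
        case False
        thus ?thesis using i j p by (simp add: P_def)
      qed
    qed (use p j \<open>2 \<le> j\<close> in \<open>auto simp: P_def\<close>)
    moreover have "set (take (Suc j) p) \<subseteq> U" using p set_take_subset[of "Suc j" p] by (auto simp: P_def)
    ultimately show False using acyclic by blast
  qed
qed

section \<open>Decomposing the complexes that remain on the new vertices\<close>

text \<open>
  Here \<open>B\<close> is the set of rejected vertices and \<open>U\<close> indexes the new vertices that are still undecided.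
  All the other vertices are cone points, so they count for the final simplex without being
  mentioned.
\<close>

definition whisker_complex :: "('a::finite + 'a) set \<Rightarrow> 'a set \<Rightarrow> ('a set \<Rightarrow> bool) \<Rightarrow> ('a + 'a) set set" where
  "whisker_complex B U P = {S. S \<inter> B = {} \<and> P {i\<in>U. Inr i \<in> S}}"

lemma decomposable_whisker_complex_shed:
  assumes "v \<in> U" "Inr v \<notin> B"
    and "decomposable d (whisker_complex B (U - {v}) (\<lambda>Z. P (insert v Z)))"
    and "decomposable d (whisker_complex (insert (Inr v) B) (U - {v}) P)"
  shows "decomposable d (whisker_complex B U P)"
proof (rule decomposable.shed[where v = "Inr v"])
  have "{i \<in> U. Inr i \<in> insert (Inr v) S} = insert v {i \<in> U - {v}. Inr i \<in> S}" for S :: "('a + 'a) set"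
    using assms(1) by auto
  hence "{S. insert (Inr v) S \<in> whisker_complex B U P} = whisker_complex B (U - {v}) (\<lambda>Z. P (insert v Z))"
    using assms(2) by (simp add: whisker_complex_def)
  with assms(3) show "decomposable d {S. insert (Inr v) S \<in> whisker_complex B U P}" by simp
  have "{i \<in> U. Inr i \<in> S} = {i \<in> U - {v}. Inr i \<in> S}" if "Inr v \<notin> S" for S :: "('a + 'a) set"
    using that by auto
  hence "{S \<in> whisker_complex B U P. Inr v \<notin> S} = whisker_complex (insert (Inr v) B) (U - {v}) P"
    by (auto simp: whisker_complex_def)
  with assms(4) show "decomposable d {S \<in> whisker_complex B U P. Inr v \<notin> S}" by simp
qed

lemma whisker_complex_cong:
  assumes "\<And>S. S \<inter> B = {} \<Longrightarrow> P {i\<in>U. Inr i \<in> S} \<longleftrightarrow> Q {i\<in>V. Inr i \<in> S}"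
  shows "whisker_complex B U P = whisker_complex B V Q"
  using assms by (auto simp: whisker_complex_def)

lemma whisker_complex_full:
  assumes "\<And>Z. Z \<subseteq> U \<Longrightarrow> P Z"
  shows "whisker_complex B U P = Pow (- B)"
  using assms by (auto simp: whisker_complex_def)

lemma whisker_complex_void:
  assumes "\<And>Z. Z \<subseteq> U \<Longrightarrow> \<not> P Z"
  shows "whisker_complex B U P = {}"
  using assms by (auto simp: whisker_complex_def)

lemma card_Compl_insert: "x \<notin> B \<Longrightarrow> Suc (card (- insert x B)) = card (- B :: 'b::finite set)"
proof -
  assume "x \<notin> B"
  hence "- B = insert x (- insert x B)" by auto
  moreover have "card (insert x (- insert x B)) = Suc (card (- insert x B))" by simp
  ultimately show ?thesis by simp
qed

text \<open>
  Deciding about every undecided vertex loses at most one vertex each time, whatever the condition \<open>P\<close>.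
\<close>

lemma decomposable_whisker_complex:
  fixes U :: "'a::finite set"
  assumes "d + card U \<le> card (- B)" "B \<inter> Inr ` U = {}"
  shows "decomposable d (whisker_complex B U P)"
proof -
  have "finite U" by simp
  thus ?thesis using assms
  proof (induction U arbitrary: B P rule: finite_induct)
    case empty
    have "whisker_complex B {} P = (if P {} then Pow (- B) else {})"
      by (auto simp: whisker_complex_def)
    with empty show ?case by (auto intro: decomposable.simplex decomposable.void)
  next
    case (insert v U)
    have v: "Inr v \<notin> B" using insert.prems by auto
    have U: "insert v U - {v} = U" using insert.hyps by simp
    show ?case
    proof (rule decomposable_whisker_complex_shed[of v])
      show "decomposable d (whisker_complex B (insert v U - {v}) (\<lambda>Z. P (insert v Z)))"
        unfolding U by (rule insert.IH) (use insert in auto)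
      show "decomposable d (whisker_complex (insert (Inr v) B) (insert v U - {v}) P)"
        unfolding U by (rule insert.IH) (use insert card_Compl_insert[OF v] in auto)
    qed (use v in auto)
  qed
qed

text \<open>
  The condition \<open>|Z| + \<nu>(H[U - Z]) < q\<close>, written without the matching number.
\<close>

definition slack :: "'a::finite set set \<Rightarrow> nat \<Rightarrow> 'a set \<Rightarrow> 'a set \<Rightarrow> bool" where
  "slack H q U Z \<longleftrightarrow> (\<forall>M. matching H M \<and> \<Union>M \<subseteq> U - Z \<longrightarrow> card Z + card M < q)"

lemma slack_insert:
  fixes H :: "'a::finite set set"
  assumes "Z \<subseteq> U - {v}"
  shows "slack H (Suc q) U (insert v Z) \<longleftrightarrow> slack H q (U - {v}) Z"
proof -
  have "U - insert v Z = U - {v} - Z" "card (insert v Z) = Suc (card Z)"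
    using assms by (auto intro: card_insert_disjoint)
  thus ?thesis by (simp add: slack_def)
qed

lemma slack_isolated:
  assumes "\<And>e. e \<in> H \<Longrightarrow> e \<subseteq> U \<Longrightarrow> v \<notin> e"
  shows "slack H q U Z \<longleftrightarrow> slack H q (U - {v}) Z"
proof -
  have "\<Union>M \<subseteq> U - Z \<longleftrightarrow> \<Union>M \<subseteq> U - {v} - Z" if "matching H M" for M
    using that assms by (fastforce simp: matching_def)
  thus ?thesis by (auto simp: slack_def)
qed

text \<open>
  For \<open>w \<in> Z\<close> the leaf \<open>v\<close> becomes isolated, and \<open>w\<close> accounts for one element of \<open>Z\<close>. For \<open>w \<notin> Z\<close>, a maximum
  matching of \<open>H[U - Z]\<close> can be taken to contain the edge \<open>{v, w}\<close>. Either way the bound drops by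
  one, and so membership of \<open>w\<close> in \<open>Z\<close> is irrelevant as long as \<open>v \<notin> Z\<close>.
\<close>

lemma slack_leaf:
  fixes H :: "'a::finite set set"
  assumes leaf: "\<And>e. e \<in> H \<Longrightarrow> e \<subseteq> U \<Longrightarrow> v \<in> e \<Longrightarrow> e = {v, w}"
    and vw: "{v, w} \<in> H" "v \<in> U" "w \<in> U" "v \<noteq> w" and Z: "Z \<subseteq> U - {v}"
  shows "slack H (Suc q) U Z \<longleftrightarrow> slack H q (U - {v} - {w}) (Z - {w})"
proof (cases "w \<in> Z")
  case True
  have "v \<notin> \<Union>M" if "matching H M" "\<Union>M \<subseteq> U - Z" for M
    using that leaf True by (fastforce simp: matching_def)
  hence "\<Union>M \<subseteq> U - Z \<longleftrightarrow> \<Union>M \<subseteq> U - {v} - {w} - (Z - {w})" if "matching H M" for M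
    using that True by blast
  moreover have "card Z = Suc (card (Z - {w}))" using True by (intro card.remove) auto
  ultimately show ?thesis by (auto simp: slack_def)
next
  case False
  hence Zw: "Z - {w} = Z" by simp
  show ?thesis
    unfolding Zw
  proof
    assume *: "slack H (Suc q) U Z"
    show "slack H q (U - {v} - {w}) Z"
      unfolding slack_def
    proof (intro allI impI)
      fix M assume M: "matching H M \<and> \<Union>M \<subseteq> U - {v} - {w} - Z"
      have "{v, w} \<inter> \<Union>M = {}" using M by blast
      with M vw(1) have "matching H (insert {v, w} M)" "card (insert {v, w} M) = Suc (card M)"
        by (auto intro: matching_insert)
      moreover have "\<Union>(insert {v, w} M) \<subseteq> U - Z" using M vw Z False by auto
      ultimately show "card Z + card M < q" using * unfolding slack_def by fastforce
    qed
  next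
    assume *: "slack H q (U - {v} - {w}) Z"
    show "slack H (Suc q) U Z"
      unfolding slack_def
    proof (intro allI impI)
      fix M assume M: "matching H M \<and> \<Union>M \<subseteq> U - Z"
      let ?N = "{e \<in> M. e \<inter> {w} = {}}"
      have "matching H ?N" using M by (blast intro: matching_subset)
      moreover have "\<Union>?N \<subseteq> U - {v} - {w} - Z"
        using M leaf by (fastforce simp: matching_def)
      ultimately have "card Z + card ?N < q" using * by (auto simp: slack_def)
      moreover have "card M \<le> 1 + card ?N" using card_matching_le[of H M "{w}"] M by simp
      ultimately show "card Z + card M < Suc q" by simp
    qed
  qed
qed

lemma slack_antimono_empty:
  assumes "slack H q U Z"
  shows "slack H q U {}"
  unfolding slack_def
proof (intro allI impI)
  fix M assume M: "matching H M \<and> \<Union>M \<subseteq> U - {}"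
  let ?N = "{e \<in> M. e \<inter> Z = {}}"
  have "matching H ?N" using M by (blast intro: matching_subset)
  moreover have "\<Union>?N \<subseteq> U - Z" using M by blast
  ultimately have "card Z + card ?N < q" using assms unfolding slack_def by blast
  moreover have "card M \<le> card Z + card ?N" using M by (intro card_matching_le) auto
  ultimately show "card {} + card M < q" by simp
qed

text \<open>
  The number of cone points is \<open>|- B| - |U|\<close>; the numerical hypotheses say that \<open>q - 1\<close> further
  vertices suffice to reach \<open>d\<close>, and that there are \<open>d\<close> vertices at all. When the whisker
  of a leaf is rejected, one vertex is lost and \<open>q\<close> drops by one; this is made up for by the leaf and
  its neighbour leaving \<open>U\<close>, the neighbour as the index of a new cone point.
\<close>

lemma decomposable_forest:
  fixes H :: "'a::finite set set"
  assumes H: "simple_graph H" and "\<And>c. is_cycle H c \<Longrightarrow> \<not> set c \<subseteq> U"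
    and "d + card U + 1 \<le> card (- B) + q" "d \<le> card (- B)" "B \<inter> Inr ` U = {}"
  shows "decomposable d (whisker_complex B U (slack H q U))"
  using assms(2-)
proof (induction "card U" arbitrary: U B q rule: less_induct)
  case (less U B q)
  show ?case
  proof (cases q)
    case 0
    have "whisker_complex B U (slack H q U) = {}"
    proof (rule whisker_complex_void)
      fix Z
      have "matching H {}" by (simp add: matching_def disjoint_def)
      moreover have "\<Union>{} \<subseteq> U - Z" by simp
      ultimately show "\<not> slack H q U Z" unfolding slack_def 0 by blast
    qed
    thus ?thesis by (simp add: decomposable.void)
  next
    case (Suc q')
    show ?thesis
    proof (cases "card U \<le> q'")
      case True
      have "slack H q U Z" if Z: "Z \<subseteq> U" for Z
        unfolding slack_def
      proof (intro allI impI)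
        fix M assume M: "matching H M \<and> \<Union>M \<subseteq> U - Z"
        have "card M \<le> card (U - Z)"
        proof (rule card_disjoint_le)
          show "disjoint M" using M by (simp add: matching_def)
          fix e assume e: "e \<in> M"
          hence "e \<noteq> {}" using M edge_nonempty[OF H] by (auto simp: matching_def)
          moreover have "e \<subseteq> U - Z" using M e by blast
          ultimately show "e \<inter> (U - Z) \<noteq> {}" by blast
        qed simp
        moreover have "card Z + card (U - Z) = card U"
          using Z by (simp add: card_Diff_subset card_mono)
        ultimately show "card Z + card M < q" using True Suc by simp
      qed
      hence "whisker_complex B U (slack H q U) = Pow (- B)" by (rule whisker_complex_full)
      thus ?thesis using less.prems by (simp add: decomposable.simplex)
    next
      case False
      hence "U \<noteq> {}" by auto
      from low_degree_vertex[OF H less.prems(1) this]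
      obtain v w where v: "v \<in> U" and deg: "\<And>e. e \<in> H \<Longrightarrow> e \<subseteq> U \<Longrightarrow> v \<in> e \<Longrightarrow> e = {v, w}"
        by metis
      have vB: "Inr v \<notin> B" using v less.prems by auto
      have cardU: "card U = Suc (card (U - {v}))" using v by (intro card.remove) auto
      show ?thesis
      proof (rule decomposable_whisker_complex_shed[OF v vB])
        have eq: "whisker_complex B (U - {v}) (\<lambda>Z. slack H q U (insert v Z))
            = whisker_complex B (U - {v}) (slack H q' (U - {v}))"
          by (rule whisker_complex_cong) (auto simp: Suc intro!: slack_insert)
        show "decomposable d (whisker_complex B (U - {v}) (\<lambda>Z. slack H q U (insert v Z)))"
          unfolding eq by (rule less.hyps) (use less.prems cardU Suc in auto)
        show "decomposable d (whisker_complex (insert (Inr v) B) (U - {v}) (slack H q U))"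
        proof (cases "\<exists>e\<in>H. e \<subseteq> U \<and> v \<in> e")
          case no_nbr: False
          have eq: "whisker_complex (insert (Inr v) B) (U - {v}) (slack H q U)
              = whisker_complex (insert (Inr v) B) (U - {v}) (slack H q (U - {v}))"
            by (rule whisker_complex_cong, rule slack_isolated) (use no_nbr in blast)
          show ?thesis
            unfolding eq
            by (rule less.hyps) (use less.prems cardU card_Compl_insert[OF vB] False Suc in auto)
        next
          case True
          with deg have vw: "{v, w} \<in> H" "w \<in> U" by auto
          hence "v \<noteq> w" using H by (auto simp: simple_graph_def)
          have eq: "whisker_complex (insert (Inr v) B) (U - {v}) (slack H q U)
              = whisker_complex (insert (Inr v) B) (U - {v} - {w}) (slack H q' (U - {v} - {w}))"
          proof (rule whisker_complex_cong)
            fix S :: "('a + 'a) set"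
            have "{i \<in> U - {v} - {w}. Inr i \<in> S} = {i \<in> U - {v}. Inr i \<in> S} - {w}" by auto
            thus "slack H q U {i \<in> U - {v}. Inr i \<in> S}
                \<longleftrightarrow> slack H q' (U - {v} - {w}) {i \<in> U - {v} - {w}. Inr i \<in> S}"
              unfolding Suc by (simp only:) (rule slack_leaf[OF deg vw(1) v vw(2) \<open>v \<noteq> w\<close>], auto)
          qed
          have "card (U - {v}) = Suc (card (U - {v} - {w}))"
            using vw(2) \<open>v \<noteq> w\<close> by (intro card.remove) auto
          thus ?thesis
            unfolding eq
            by (intro less.hyps) (use less.prems cardU card_Compl_insert[OF vB] False Suc in auto)
        qed
      qed
    qed
  qed
qed

section \<open>Matchings of whisker graphs\<close>

lemma matching_whiskers:
  fixes H :: "'a::finite set set"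
  assumes H: "simple_graph H" and M: "matching H M" "\<Union>M \<inter> Z = {}"
  shows "matching (whisker H) ((`) Inl ` M \<union> (\<lambda>i. {Inl i, Inr i}) ` Z)"
    and "card ((`) Inl ` M \<union> (\<lambda>i. {Inl i, Inr i}) ` Z) = card M + card Z"
proof -
  let ?A = "(`) Inl ` M :: ('a + 'a) set set" and ?B = "(\<lambda>i. {Inl i, Inr i}) ` Z :: ('a + 'a) set set"
  have ne: "e \<noteq> {}" if "e \<in> M" for e
    using M(1) that edge_nonempty[OF H] by (auto simp: matching_def)
  have "disjnt a b" if ab: "a \<in> ?A \<union> ?B" "b \<in> ?A \<union> ?B" "a \<noteq> b" for a b
  proof -
    have MM: "e \<inter> f = {}" if "e \<in> M" "f \<in> M" "e \<noteq> f" for e f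
      using M(1) that by (simp add: matching_def disjoint_def)
    have MZ: "i \<notin> e" if "i \<in> Z" "e \<in> M" for i e using M(2) that by blast
    show ?thesis
      using ab(1,2)
    proof (elim UnE imageE)
      fix e f assume "a = Inl ` e" "e \<in> M" "b = Inl ` f" "f \<in> M"
      with MM[of e f] ab(3) show ?thesis unfolding disjnt_def by blast
    next
      fix e i assume "a = Inl ` e" "e \<in> M" "b = {Inl i, Inr i}" "i \<in> Z"
      with MZ[of i e] show ?thesis unfolding disjnt_def by blast
    next
      fix e i assume "b = Inl ` e" "e \<in> M" "a = {Inl i, Inr i}" "i \<in> Z"
      with MZ[of i e] show ?thesis unfolding disjnt_def by blast
    next
      fix i j assume "a = {Inl i, Inr i}" "b = {Inl j, Inr j}"
      with ab(3) show ?thesis unfolding disjnt_def by blast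
    qed
  qed
  hence "pairwise disjnt (?A \<union> ?B)" by (simp add: pairwise_def)
  moreover have "?A \<union> ?B \<subseteq> whisker H" using M(1) by (auto simp: matching_def whisker_def)
  ultimately show "matching (whisker H) (?A \<union> ?B)" by (simp add: matching_def)
  have "?A \<inter> ?B = {}" by blast
  moreover have "card ?A = card M" by (rule card_image) (auto intro: inj_onI simp: inj_image_eq_iff)
  moreover have "card ?B = card Z" by (rule card_image) (auto intro!: inj_onI simp: doubleton_eq_iff)
  ultimately show "card (?A \<union> ?B) = card M + card Z" by (simp add: card_Un_disjoint)
qed

lemma whisker_edge_cases:
  assumes "e \<in> whisker H"
  obtains f where "f \<in> H" "e = Inl ` f" | i where "e = {Inl i, Inr i}"
  using assms by (auto simp: whisker_def)

lemma whisker_edge_meets: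
  assumes "simple_graph H" "e \<in> whisker H"
  shows "e \<inter> range Inl \<noteq> {}"
  using assms(2) by (rule whisker_edge_cases) (use edge_nonempty[OF assms(1)] in auto)

text \<open>
  Every edge has an original vertex, so disjoint edges inside \<open>S\<close> use different elements of \<open>X\<close>.
\<close>

lemma few_originals_matching_free:
  fixes H :: "'a::finite set set"
  assumes "simple_graph H" "card X < q" "S \<inter> Inl ` (- X) = {}"
  shows "S \<in> matching_free (whisker H) q"
  unfolding matching_free_def
proof safe
  fix M assume M: "matching (whisker H) M" "\<Union>M \<subseteq> S" "q = card M"
  have "card M \<le> card (Inl ` X :: ('a + 'a) set)"
  proof (rule card_disjoint_le)
    show "disjoint M" using M(1) by (simp add: matching_def)
    fix e assume e: "e \<in> M"
    then obtain i where "Inl i \<in> e"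
      using whisker_edge_meets[OF assms(1), of e] M(1) by (auto simp: matching_def)
    moreover have "i \<in> X" using e \<open>Inl i \<in> e\<close> M(2) assms(3) by blast
    ultimately show "e \<inter> Inl ` X \<noteq> {}" by blast
  qed simp
  also have "\<dots> = card X" by (simp add: card_image)
  finally show False using assms(2) M(3) by simp
qed

text \<open>
  A matching of \<open>H\<close> that avoids \<open>Z\<close> can be extended by all whiskers at \<open>Z\<close>. Conversely, discarding from a
  matching of the whisker graph the edges that meet an original vertex of \<open>Z\<close> costs at most \<open>|Z|\<close>
  edges and leaves a matching of \<open>H[X - Z]\<close>.
\<close>

lemma matching_free_iff_slack:
  fixes H :: "'a::finite set set"
  assumes H: "simple_graph H" and S: "S \<inter> Inl ` (- X) = {}"
  shows "S \<union> Inl ` X \<in> matching_free (whisker H) q \<longleftrightarrow> slack H q X {i\<in>X. Inr i \<in> S}"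
proof -
  define Z where "Z = {i\<in>X. Inr i \<in> S}"
  have "S \<union> Inl ` X \<notin> matching_free (whisker H) q \<longleftrightarrow> \<not> slack H q X Z"
  proof
    assume "\<not> slack H q X Z"
    then obtain M where M: "matching H M" "\<Union>M \<subseteq> X - Z" "q \<le> card Z + card M"
      unfolding slack_def by (auto simp: not_less)
    let ?M = "(`) Inl ` M \<union> (\<lambda>i. {Inl i, Inr i}) ` Z"
    have "\<Union>M \<inter> Z = {}" using M(2) by blast
    note M' = matching_whiskers[OF H M(1) this]
    obtain N where N: "N \<subseteq> ?M" "card N = q"
      using obtain_subset_with_card_n[of q ?M] M'(2) M(3) by auto
    have "\<Union>?M \<subseteq> S \<union> Inl ` X" using M(2) by (auto simp: Z_def)
    with N have "\<Union>N \<subseteq> S \<union> Inl ` X" by blast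
    with N matching_subset[OF M'(1)] show "S \<union> Inl ` X \<notin> matching_free (whisker H) q"
      by (auto simp: matching_free_def)
  next
    assume "S \<union> Inl ` X \<notin> matching_free (whisker H) q"
    then obtain M where M: "matching (whisker H) M" "card M = q" "\<Union>M \<subseteq> S \<union> Inl ` X"
      by (auto simp: matching_free_def)
    define N where "N = {f. Inl ` f \<in> M \<and> f \<inter> Z = {}}"
    have X: "i \<in> X" if "e \<in> M" "Inl i \<in> e" for e i
      using that M(3) S by blast
    have rest: "{e \<in> M. e \<inter> Inl ` Z = {}} = (`) Inl ` N"
    proof
      show "(`) Inl ` N \<subseteq> {e \<in> M. e \<inter> Inl ` Z = {}}" by (auto simp: N_def)
      show "{e \<in> M. e \<inter> Inl ` Z = {}} \<subseteq> (`) Inl ` N"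
      proof
        fix e assume "e \<in> {e \<in> M. e \<inter> Inl ` Z = {}}"
        hence e: "e \<in> M" "e \<inter> Inl ` Z = {}" by auto
        hence "e \<in> whisker H" using M(1) by (auto simp: matching_def)
        thus "e \<in> (`) Inl ` N"
        proof (cases rule: whisker_edge_cases)
          case (1 f)
          have "f \<inter> Z = {}" using e(2) unfolding 1(2) by blast
          with e 1 show ?thesis by (auto simp: N_def)
        next
          case (2 i)
          have "i \<in> X" using X[OF e(1)] 2 by blast
          moreover have "Inr i \<in> S" using e(1) 2 M(3) by blast
          ultimately show ?thesis using e(2) 2 by (auto simp: Z_def)
        qed
      qed
    qed
    have "matching H N"
      unfolding matching_def
    proof
      show "N \<subseteq> H"
      proof
        fix f assume "f \<in> N"
        hence "Inl ` f \<in> whisker H" using M(1) by (auto simp: N_def matching_def)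
        thus "f \<in> H" by (rule whisker_edge_cases) (auto simp: inj_image_eq_iff)
      qed
      have "disjnt f g" if "f \<in> N" "g \<in> N" "f \<noteq> g" for f g
      proof -
        have "Inl ` f \<in> M" "Inl ` g \<in> M" "Inl ` f \<noteq> (Inl ` g :: ('a + 'a) set)"
          using that by (auto simp: N_def inj_image_eq_iff)
        hence "disjnt (Inl ` f) (Inl ` g :: ('a + 'a) set)" using M(1) by (auto simp: matching_def pairwise_def)
        thus ?thesis by (auto simp: disjnt_def)
      qed
      thus "disjoint N" by (simp add: pairwise_def)
    qed
    moreover have "\<Union>N \<subseteq> X - Z"
    proof
      fix i assume "i \<in> \<Union>N"
      then obtain f where f: "f \<in> N" "i \<in> f" by blast
      hence "i \<in> X" using X[of "Inl ` f" i] by (auto simp: N_def)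
      with f show "i \<in> X - Z" by (auto simp: N_def)
    qed
    moreover have "card M \<le> card (Inl ` Z :: ('a + 'a) set) + card {e \<in> M. e \<inter> Inl ` Z = {}}"
      using M(1) by (rule card_matching_le) simp
    hence "q \<le> card Z + card N"
      by (simp add: M(2) rest card_image inj_on_def inj_image_eq_iff)
    ultimately show "\<not> slack H q X Z" unfolding slack_def by (auto simp: not_less)
  qed
  thus ?thesis by (simp add: Z_def)
qed

lemma card_plus_card_Compl: "card A + card (- A) = CARD('b)" for A :: "'b::finite set"
  using card_Un_disjoint[of A "- A"] by (simp add: Compl_partition)

lemma card_Compl_Inl: "card (- Inl ` Y :: ('a::finite + 'a) set) = CARD('a) + card (- Y)"
proof -
  have "card (Inl ` Y :: ('a + 'a) set) = card Y" by (intro card_image) simp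
  thus ?thesis
    using card_plus_card_Compl[of "Inl ` Y :: ('a + 'a) set"] card_plus_card_Compl[of Y] by simp
qed

text \<open>
  The decisions about the original vertices. Rejecting stops as soon as fewer than \<open>q\<close> of them
  are left, which leaves a simplex with \<open>n + q - 1\<close> vertices.
\<close>

lemma decomposable_matching_free:
  fixes H :: "'a::finite set set"
  assumes H: "simple_graph H" and q: "1 \<le> q" "q \<le> CARD('a)" and d: "d \<le> CARD('a) + q - 1"
    and step: "\<And>X. q \<le> card X \<Longrightarrow> decomposable d (whisker_complex (Inl ` (- X)) X (slack H q X))"
  shows "decomposable d (matching_free (whisker H) q)"
proof -
  \<comment> \<open>The complex left when the original vertices in \<open>X\<close> are taken and those in \<open>Y\<close> are rejected.\<close>
  define xc where "xc X Y = {S. S \<inter> Inl ` Y = {} \<and> S \<union> Inl ` X \<in> matching_free (whisker H) q}" for X Y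
  have "decomposable d (xc X Y)" if "X \<union> Y \<union> R = UNIV" "(X \<union> R) \<inter> Y = {}" "X \<inter> R = {}" "q \<le> Suc (card (- Y))" for X Y R
  proof -
    have "finite R" by simp
    thus ?thesis using that
    proof (induction R arbitrary: X Y rule: finite_induct)
      case base: empty
      hence Y: "Y = - X" by auto
      show ?case
      proof (cases "q \<le> card X")
        case True
        have "xc X Y = whisker_complex (Inl ` (- X)) X (slack H q X)"
          unfolding xc_def whisker_complex_def Y
          by (intro Collect_cong conj_cong refl matching_free_iff_slack[OF H])
        with step[OF True] show ?thesis by simp
      next
        case False
        have "xc X Y = Pow (- Inl ` Y)"
          unfolding xc_def using False
          by (auto simp: Y intro!: few_originals_matching_free[OF H, of X])
        moreover have "d \<le> card (- Inl ` Y :: ('a + 'a) set)"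
          using base d q False by (simp add: card_Compl_Inl Y)
        ultimately show ?thesis by (simp add: decomposable.simplex)
      qed
    next
      case (insert v R)
      show ?case
      proof (cases "q \<le> card (- Y)")
        case False
        have "xc X Y = Pow (- Inl ` Y)"
          unfolding xc_def using False insert.prems
          by (auto intro!: few_originals_matching_free[OF H, of "- Y"])
        moreover have "d \<le> card (- Inl ` Y :: ('a + 'a) set)"
          using insert.prems d q False by (simp add: card_Compl_Inl)
        ultimately show ?thesis by (simp add: decomposable.simplex)
      next
        case True
        have v: "v \<notin> X" "v \<notin> Y" using insert.prems by auto
        show ?thesis
        proof (rule decomposable.shed[where v = "Inl v"])
          have "decomposable d (xc (insert v X) Y)"
            by (rule insert.IH) (use insert v in auto)
          moreover have "{S. insert (Inl v) S \<in> xc X Y} = xc (insert v X) Y"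
            using v by (auto simp: xc_def)
          ultimately show "decomposable d {S. insert (Inl v) S \<in> xc X Y}" by simp
          have "decomposable d (xc X (insert v Y))"
            by (rule insert.IH) (use insert v True card_Compl_insert[OF v(2)] in auto)
          moreover have "{S \<in> xc X Y. Inl v \<notin> S} = xc X (insert v Y)"
            by (auto simp: xc_def)
          ultimately show "decomposable d {S \<in> xc X Y. Inl v \<notin> S}" by simp
        qed
      qed
    qed
  qed
  from this[of "{}" "{}" UNIV] q show ?thesis by (simp add: xc_def)
qed

text \<open>
  If \<open>H[X]\<close> contains a cycle, then \<open>q\<close> disjoint edges of this cycle make the complex for \<open>X\<close> void.
\<close>

lemma decomposable_matching_free_high_girth:
  fixes H :: "'a::finite set set"
  assumes H: "simple_graph H" and q: "1 \<le> q" "q \<le> CARD('a)"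
    and cyc: "\<And>c. is_cycle H c \<Longrightarrow> 2 * q \<le> length c"
  shows "decomposable (CARD('a) + q - 1) (matching_free (whisker H) q)"
proof (rule decomposable_matching_free[OF H q order.refl])
  fix X :: "'a set"
  assume X: "q \<le> card X"
  show "decomposable (CARD('a) + q - 1) (whisker_complex (Inl ` (- X)) X (slack H q X))"
  proof (cases "slack H q X {}")
    case False
    hence "whisker_complex (Inl ` (- X)) X (slack H q X) = {}"
      by (intro whisker_complex_void) (blast dest: slack_antimono_empty)
    thus ?thesis by (simp add: decomposable.void)
  next
    case True
    have "\<not> set c \<subseteq> X" if c: "is_cycle H c" for c
    proof
      assume "set c \<subseteq> X"
      obtain M where "matching H M" "card M = q" "\<Union>M \<subseteq> set (drop 0 c)"
        by (rule path_matching[of c 0 q H])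
          (use c cyc[OF c] is_cycle_path[OF c] in \<open>auto simp: is_cycle_def\<close>)
      with True \<open>set c \<subseteq> X\<close> show False unfolding slack_def by fastforce
    qed
    thus ?thesis
      using q X by (intro decomposable_forest[OF H]) (auto simp: card_Compl_Inl)
  qed
qed

lemma decomposable_matching_free_card:
  fixes H :: "'a::finite set set"
  assumes H: "simple_graph H" and q: "1 \<le> q" "q \<le> CARD('a)"
  shows "decomposable (CARD('a)) (matching_free (whisker H) q)"
  by (rule decomposable_matching_free[OF H q])
    (use q in \<open>auto intro!: decomposable_whisker_complex simp: card_Compl_Inl\<close>)

section \<open>Two facets, and the depth\<close>

lemma depth_le_new_vertices:
  fixes H :: "'a::finite set set"
  assumes H: "simple_graph H" and q: "1 \<le> q" "q \<le> CARD('a)"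
  shows "depth_mod (sr_ideal (matching_free (whisker H) q) :: ('a + 'a, 'k::field) mpoly set)
    \<le> enat (CARD('a) + q - 1)"
proof -
  have "q - 1 \<le> card (UNIV :: 'a set)" using q by simp
  then obtain X :: "'a set" where X: "card X = q - 1"
    by (rule obtain_subset_with_card_n)
  define W :: "('a + 'a) set" where "W = - Inl ` (- X)"
  have "depth_mod (sr_ideal (matching_free (whisker H) q) :: ('a + 'a, 'k) mpoly set) \<le> enat (card W)"
  proof (rule depth_le_facet[OF down_closed_matching_free])
    show "W \<in> matching_free (whisker H) q"
      by (rule few_originals_matching_free[OF H, of X]) (use X q in \<open>auto simp: W_def\<close>)
    fix v assume "v \<notin> W"
    then obtain x where x: "v = Inl x" "x \<notin> X" by (auto simp: W_def)
    define M where "M = (`) Inl ` {} \<union> (\<lambda>i. {Inl i, Inr i :: 'a + 'a}) ` insert x X"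
    have e: "matching H {}" "\<Union>{} \<inter> insert x X = {}" by (simp_all add: matching_def)
    have "card (insert x X) = q" using X x q by simp
    hence "matching (whisker H) M" "card M = q"
      using matching_whiskers[OF H e] unfolding M_def by auto
    moreover have "\<Union>M \<subseteq> insert v W" by (auto simp: M_def W_def x)
    ultimately show "insert v W \<notin> matching_free (whisker H) q"
      by (auto simp: matching_free_def)
  qed
  moreover have "card W = CARD('a) + q - 1" using X q by (simp add: W_def card_Compl_Inl)
  ultimately show ?thesis by simp
qed

text \<open>
  The only edges inside the facet are edges between vertices of the cycle, which are too few for \<open>q\<close>
  disjoint edges. A further vertex completes a whisker, at \<open>x\<close> say, and the vertices of the cycle
  other than \<open>x\<close> still contain \<open>q - 1\<close> disjoint edges.
\<close>

lemma depth_le_odd_cycle: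
  fixes H :: "'a::finite set set"
  assumes H: "simple_graph H" and c: "is_cycle H c" "Suc (length c) = 2 * q"
  shows "depth_mod (sr_ideal (matching_free (whisker H) q) :: ('a + 'a, 'k::field) mpoly set)
    \<le> enat (CARD('a))"
proof -
  define W :: "('a + 'a) set" where "W = Inl ` set c \<union> Inr ` (- set c)"
  have len: "3 \<le> length c" and dist: "distinct c" using c(1) by (auto simp: is_cycle_def)
  have near_perfect: "\<exists>M. matching H M \<and> card M = q - 1 \<and> \<Union>M \<subseteq> set c - {x}" for x
  proof -
    have "\<exists>i. x \<in> set c \<longrightarrow> rotate i c ! 0 = x"
    proof (cases "x \<in> set c")
      case True
      then obtain i where "i < length c" "c ! i = x" by (auto simp: in_set_conv_nth)
      thus ?thesis using nth_rotate[of 0 c i] len by (intro exI[of _ i]) force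
    qed simp
    then obtain i where i: "x \<in> set c \<Longrightarrow> rotate i c ! 0 = x" by blast
    define b where "b = rotate i c"
    have b: "is_cycle H b" "distinct b" "set b = set c" "length b = length c"
      using is_cycle_rotate[OF c(1)] dist by (auto simp: b_def)
    obtain M where M: "matching H M" "card M = q - 1" "\<Union>M \<subseteq> set (drop 1 b)"
      by (rule path_matching[of b 1 "q - 1" H])
        (use b c(2) is_cycle_path[OF b(1)] in auto)
    have "set (drop 1 b) \<subseteq> set c - {x}"
    proof (cases b)
      case (Cons y ys)
      thus ?thesis using b i by (auto simp flip: b_def)
    qed simp
    with M show ?thesis by blast
  qed
  have "depth_mod (sr_ideal (matching_free (whisker H) q) :: ('a + 'a, 'k) mpoly set) \<le> enat (card W)"
  proof (rule depth_le_facet[OF down_closed_matching_free])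
    show "W \<in> matching_free (whisker H) q"
      unfolding matching_free_def
    proof safe
      fix M assume M: "matching (whisker H) M" "\<Union>M \<subseteq> W" "q = card M"
      have edge: "e \<subseteq> Inl ` set c \<and> card e = 2" if e: "e \<in> M" for e
      proof -
        have "e \<in> whisker H" "e \<subseteq> W" using M e by (auto simp: matching_def)
        thus ?thesis
        proof (cases rule: whisker_edge_cases)
          case (1 f)
          thus ?thesis using H \<open>e \<subseteq> W\<close> by (auto simp: W_def simple_graph_def card_image)
        next
          case (2 i)
          thus ?thesis using \<open>e \<subseteq> W\<close> by (auto simp: W_def)
        qed
      qed
      have "card (\<Union>M) = (\<Sum>e\<in>M. card e)"
        using M(1) by (intro card_Union_disjoint) (auto simp: matching_def)
      also have "\<dots> = 2 * card M" using edge by simp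
      finally have "2 * q \<le> card (Inl ` set c :: ('a + 'a) set)"
        using edge M(3) card_mono[of "Inl ` set c" "\<Union>M"] by auto
      thus False using c(2) dist by (simp add: card_image distinct_card)
    qed
    fix v assume v: "v \<notin> W"
    then obtain x where x: "v = Inl x \<and> x \<notin> set c \<or> v = Inr x \<and> x \<in> set c"
      by (cases v) (auto simp: W_def)
    obtain N where N: "matching H N" "card N = q - 1" "\<Union>N \<subseteq> set c - {x}"
      using near_perfect by blast
    define M where "M = (`) Inl ` N \<union> (\<lambda>i. {Inl i, Inr i :: 'a + 'a}) ` {x}"
    have "\<Union>N \<inter> {x} = {}" using N(3) by blast
    from matching_whiskers[OF H N(1) this] have "matching (whisker H) M" "card M = q"
      using N(2) c(2) unfolding M_def by auto
    moreover have "\<Union>M \<subseteq> insert v W" using N(3) x by (auto simp: M_def W_def)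
    ultimately show "insert v W \<notin> matching_free (whisker H) q"
      by (auto simp: matching_free_def)
  qed
  moreover have "card W = card (set c) + card (- set c)"
    unfolding W_def by (subst card_Un_disjoint) (auto simp: card_image)
  hence "card W = CARD('a)" by (simp add: card_plus_card_Compl)
  ultimately show ?thesis by simp
qed

lemma matching_number_whisker_le:
  fixes H :: "'a::finite set set"
  assumes "simple_graph H"
  shows "matching_number (whisker H) \<le> CARD('a)"
proof -
  have "card M \<le> CARD('a)" if M: "matching (whisker H) M" for M
  proof -
    have "card M \<le> card (range Inl :: ('a + 'a) set)"
      using M whisker_edge_meets[OF assms] by (intro card_disjoint_le) (auto simp: matching_def)
    thus ?thesis by (simp add: card_image)
  qed
  moreover have "{card M | M. matching (whisker H) M} \<noteq> {}"
    by (auto simp: matching_def intro: exI[of _ "{}"])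
  moreover have "finite {card M | M. matching (whisker H) M}" by simp
  ultimately show ?thesis unfolding matching_number_def by (subst Max_le_iff) auto
qed

lemma girth_le: "is_cycle H c \<Longrightarrow> girth H \<le> enat (length c)"
  unfolding girth_def by (rule Inf_lower) blast

lemma girth_attained:
  assumes "girth H = enat m"
  obtains c where "is_cycle H c" "length c = m"
proof -
  let ?A = "{enat (length c) | c. is_cycle H c}"
  have "?A \<noteq> {}"
  proof
    assume "?A = {}"
    hence "girth H = \<infinity>" unfolding girth_def by (simp only: Inf_enat_def simp_thms if_True)
    with assms show False by simp
  qed
  hence "Inf ?A \<in> ?A" unfolding Inf_enat_def by (auto intro: LeastI)
  with assms that show ?thesis by (auto simp: girth_def)
qed

theorem theorem1p4:
  fixes H :: "'a::finite set set"
    and n q :: nat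
    and I :: "('a + 'a, 'k::field) mpoly set"
  assumes H: "simple_graph H"
    and n: "n = CARD('a)"
    and I: "I = squarefree_power (whisker H) q"
  shows "(\<forall>m::nat. girth H = enat m \<and> 1 \<le> q \<and> int q \<le> \<lfloor>real m / 2\<rfloor>
            \<longrightarrow> depth_mod I = enat (n + q - 1))
       \<and> (\<forall>m::nat. girth H = enat m \<and> odd m \<and> int q = \<lceil>real m / 2\<rceil>
            \<longrightarrow> depth_mod I = enat n)
       \<and> (girth H = \<infinity> \<and> 1 \<le> q \<and> q \<le> matching_number (whisker H)
            \<longrightarrow> depth_mod I = enat (n + q - 1))"
proof -
  have I': "I = sr_ideal (matching_free (whisker H) q)" by (simp add: I squarefree_power_eq)
  have lower: "enat d \<le> depth_mod I" if "decomposable d (matching_free (whisker H) q)" "1 \<le> q" for d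
  proof -
    have "{} \<in> matching_free (whisker H) q"
      using few_originals_matching_free[OF H, of "{}" q "{}"] that(2) by simp
    thus ?thesis unfolding I' by (intro depth_ge_decomposable[OF that(1) down_closed_matching_free])
  qed
  have main: "depth_mod I = enat (n + q - 1)"
    if "1 \<le> q" "q \<le> CARD('a)" "\<And>c. is_cycle H c \<Longrightarrow> 2 * q \<le> length c"
    using lower[OF decomposable_matching_free_high_girth[OF H that] that(1)]
      depth_le_new_vertices[OF H that(1,2), where 'k = 'k]
    by (simp add: I' n)
  have len: "length c \<le> CARD('a)" if "is_cycle H c" for c :: "'a list"
    using that distinct_card[of c] card_mono[of UNIV "set c"] by (auto simp: is_cycle_def)
  show ?thesis
  proof (intro conjI allI impI; elim conjE)
    fix m assume m: "girth H = enat m" and q: "1 \<le> q" "int q \<le> \<lfloor>real m / 2\<rfloor>"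
    have "2 * q \<le> m" using q(2) by (simp add: le_floor_iff)
    moreover obtain c where "is_cycle H c" "length c = m" using m by (rule girth_attained)
    ultimately show "depth_mod I = enat (n + q - 1)"
      using q(1) len[of c] m girth_le[of H] by (intro main) force+
  next
    fix m assume m: "girth H = enat m" "odd m" "int q = \<lceil>real m / 2\<rceil>"
    have mq: "Suc m = 2 * q"
    proof -
      from m(2) obtain k where k: "m = 2 * k + 1" by (rule oddE)
      have "\<lceil>real m / 2\<rceil> = int k + 1" unfolding k by (rule ceiling_unique) auto
      with m(3) k show ?thesis by simp
    qed
    obtain c where c: "is_cycle H c" "length c = m" using m(1) by (rule girth_attained)
    have "3 \<le> length c" using c(1) by (simp add: is_cycle_def)
    hence q: "1 \<le> q" "q \<le> CARD('a)" using mq c(2) len[OF c(1)] by auto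
    show "depth_mod I = enat n"
      using lower[OF decomposable_matching_free_card[OF H q] q(1)]
        depth_le_odd_cycle[OF H c(1), of q, where 'k = 'k] mq c(2)
      by (simp add: I' n)
  next
    assume inf: "girth H = \<infinity>" and q: "1 \<le> q" "q \<le> matching_number (whisker H)"
    have "\<not> is_cycle H c" for c using girth_le[of H c] inf by auto
    thus "depth_mod I = enat (n + q - 1)"
      using q matching_number_whisker_le[OF H] by (intro main) auto
  qed
qed

end
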